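(* Let $S$ be a set of positive integers. Then $$\sum_{\Pi}a^{o(\Pi)}q^{|\Pi|}=\prod_{i\in S}\left(\frac{\prod_{j\in S}(1+aq^{i+j})}{(1-q^i)(1-aq^i)} \prod_{\substack{j\in S\\ j<i}}\frac{1}{(1-q^{i+j})(1-a^2q^{i+j})}\right),$$ where the sum runs over all plane overpartitions $\Pi$ (the empty one included) all of whose entries (ignoring overlines) lie in $S$.
   Context: A plane overpartition is a filling of the Ferrers diagram of a partition with positive integers, weakly decreasing along rows (left to right) and columns (top to bottom), with some entries overlined subject to: (1) in each row, only the last (rightmost) occurrence of a given integer may be overlined; (2) in each column, the first (topmost) occurrence of a given integer may be overlined or not, and all other occurrences of that integer in the column are overlined. $|\Pi|$ is the sum of entries (ignoring overlines), $o(\Pi)$ the number of overlined entries. The identity is of formal power series in $q$. *)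

theory Defs
  imports "HOL-Analysis.Analysis" "HOL-Computational_Algebra.Formal_Power_Series"
begin

text \<open>
  A partition is a weakly decreasing list of positive parts.  A filling of its Ferrers diagram is
  a list of rows; the entry in cell (i, j), row i and column j counted from 0 at the top left, is a
  positive integer together with a flag that says whether it is overlined.
\<close>

definition is_partition :: "nat list \<Rightarrow> bool" where
  "is_partition l \<longleftrightarrow> sorted_wrt (\<ge>) l \<and> 0 \<notin> set l"

type_synonym filling = "(nat \<times> bool) list list"

definition shape :: "filling \<Rightarrow> nat list" where
  "shape P = map length P"

definition cells :: "filling \<Rightarrow> (nat \<times> nat) set" where
  "cells P = {(i, j). i < length (shape P) \<and> j < shape P ! i}"

definition entry :: "filling \<Rightarrow> nat \<Rightarrow> nat \<Rightarrow> nat" where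
  "entry P i j = fst (P ! i ! j)"

definition overlined :: "filling \<Rightarrow> nat \<Rightarrow> nat \<Rightarrow> bool" where
  "overlined P i j \<longleftrightarrow> snd (P ! i ! j)"

definition plane_overpartition :: "filling \<Rightarrow> bool" where
  "plane_overpartition P \<longleftrightarrow>
     is_partition (shape P) \<and>
     (\<forall>(i, j) \<in> cells P. 0 < entry P i j) \<and>
     (\<forall>i j j'. (i, j) \<in> cells P \<and> (i, j') \<in> cells P \<and> j < j' \<longrightarrow> entry P i j' \<le> entry P i j) \<and>
     (\<forall>i i' j. (i, j) \<in> cells P \<and> (i', j) \<in> cells P \<and> i < i' \<longrightarrow> entry P i' j \<le> entry P i j) \<and>
     (\<forall>i j j'. (i, j) \<in> cells P \<and> (i, j') \<in> cells P \<and> j < j' \<and> entry P i j' = entry P i j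
        \<longrightarrow> \<not> overlined P i j) \<and>
     (\<forall>i i' j. (i, j) \<in> cells P \<and> (i', j) \<in> cells P \<and> i < i' \<and> entry P i' j = entry P i j
        \<longrightarrow> overlined P i' j)"

definition plane_overpartitions_in :: "nat set \<Rightarrow> filling set" where
  "plane_overpartitions_in S =
     {P. plane_overpartition P \<and> (\<forall>(i, j) \<in> cells P. entry P i j \<in> S)}"

definition weight :: "filling \<Rightarrow> nat" where
  "weight P = (\<Sum>(i, j) \<in> cells P. entry P i j)"

definition num_overlined :: "filling \<Rightarrow> nat" where
  "num_overlined P = card {(i, j) \<in> cells P. overlined P i j}"

text \<open>
  The variable q is \<^term>\<open>fps_X\<close>, and a is an arbitrary element of an arbitrary field; the case of
  an indeterminate a is that of a field of rational functions in a.  Limits of formal power series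
  are taken in the library's metric on them, that is, coefficient by coefficient.
  Products over a possibly infinite set S of indices are written as products over all
  natural numbers, with factor 1 outside S.
\<close>

definition numerator_factor :: "nat set \<Rightarrow> 'a::field \<Rightarrow> nat \<Rightarrow> nat \<Rightarrow> 'a fps" where
  "numerator_factor S a i j = (if j \<in> S then 1 + fps_const a * fps_X ^ (i + j) else 1)"

definition product_factor :: "nat set \<Rightarrow> 'a::field \<Rightarrow> nat \<Rightarrow> 'a fps" where
  "product_factor S a i =
     (if i \<in> S then
        (\<Prod>j. numerator_factor S a i j) / ((1 - fps_X ^ i) * (1 - fps_const a * fps_X ^ i)) *
        (\<Prod>j \<in> {j \<in> S. j < i}.
           1 / ((1 - fps_X ^ (i + j)) * (1 - fps_const (a ^ 2) * fps_X ^ (i + j))))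
      else 1)"

end

theory Submission
  imports Defs
begin

text \<open>
  The cells of a plane overpartition with a given entry form a horizontal strip (not overlined)
  followed by a vertical strip (overlined).  So the generating function of a given shape is obtained
  from the empty partition by operators \<open>U x\<close> and \<open>V y\<close> that attach a weighted horizontal or
  vertical strip, one pair with \<open>x = q^i\<close>, \<open>y = a * q^i\<close> for each \<open>i \<in> S\<close>, the smallest \<open>i\<close> last.
  If \<open>D x\<close> removes a horizontal strip, then reflecting the parts of a partition gives
  \<open>(1 - x * z) * D x * U z = U z * D x\<close> and, summing over all shapes, \<open>(1 - x) * \<Sum> U x = \<Sum> D x\<close>;
  moreover \<open>V y\<close> is the inverse of \<open>U (- y)\<close>.  The vector built from the empty partition is thus a
  common eigenvector of all \<open>D x\<close>, and its total sum is multiplied by a known factor whenever a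
  strip operator is applied.
\<close>

unbundle no vec_syntax
unbundle fps_syntax

subsection \<open>Partitions and graded sums over them\<close>

text \<open>The eigenvalue of \<open>D x\<close> on the vector for S is the product over j \<in> S
  of (1 + a x q^j) / (1 - x q^j). Adding a new smallest part i multiplies the total sum by its value
  at x = q^i and divides by its value at x = - a q^i; the latter is the origin of the factors 1 -
  a^2 q^(i+j). The factors 1 - q^i and 1 - a q^i come from the sum formula itself, and 1 + a q^(2i)
  from the interaction of the two strips for the same i. So \<open>D x\<close> is studied for all x
  at once, with the eigenvalue as a function of x. \<open>V y\<close> gets its sum formula
  indirectly: that of \<open>U\<close> is applied at - y to \<open>V y w\<close>, which
  \<open>U (- y)\<close> sends back to w. The infinite sums over shapes make sense because the
  vectors are graded, the entry at l being divisible by q to the size of l; this allows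
  \<open>D x\<close> even for x with a constant term. Strips are attached from the largest part
  down, so an infinite S offers no place to start. The formula is proved for finite S, and the
  coefficient of q^n is traced back to the parts up to n.\<close>

definition partitions :: "(nat \<Rightarrow> nat) set" where
  "partitions = {l. antimono l \<and> finite {i. l i \<noteq> 0}}"

definition psize :: "(nat \<Rightarrow> nat) \<Rightarrow> nat" where
  "psize l = (\<Sum>i | l i \<noteq> 0. l i)"

lemma psize_eq_sum:
  assumes "\<And>i. i \<ge> N \<Longrightarrow> l i = 0"
  shows "psize l = (\<Sum>i<N. l i)"
  unfolding psize_def
  by (rule sum.mono_neutral_left) (use assms not_less in auto)

lemma partitions_antimono: "l \<in> partitions \<Longrightarrow> i \<le> j \<Longrightarrow> l j \<le> l i"
  by (auto simp: partitions_def antimono_def)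

lemma partitions_bounded:
  assumes "l \<in> partitions"
  obtains N where "\<And>i. i \<ge> N \<Longrightarrow> l i = 0"
proof -
  have "finite {i. l i \<noteq> 0}"
    using assms by (simp add: partitions_def)
  then obtain N where "\<forall>i\<in>{i. l i \<noteq> 0}. i < N"
    using finite_nat_set_iff_bounded by blast
  then show ?thesis
    using that[of N] by (metis mem_Collect_eq not_le)
qed

lemma partitionsI:
  assumes "\<And>i. l (Suc i) \<le> l i" "\<And>i. i \<ge> N \<Longrightarrow> l i = 0"
  shows "l \<in> partitions"
proof -
  have "i < N" if "l i \<noteq> 0" for i
    using that assms(2)[of i] by (cases "i < N") auto
  then have "{i. l i \<noteq> 0} \<subseteq> {..<N}"
    by auto
  then have "finite {i. l i \<noteq> 0}"
    by (rule finite_subset) simp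
  then show ?thesis
    using assms(1) by (simp add: partitions_def decseq_Suc_iff)
qed

lemma part_le_psize:
  assumes "l \<in> partitions"
  shows "l i \<le> psize l"
proof (cases "l i = 0")
  case False
  then show ?thesis
    using assms unfolding psize_def partitions_def by (intro member_le_sum) auto
qed simp

lemma part_eq_0:
  assumes l: "l \<in> partitions" and i: "psize l \<le> i"
  shows "l i = 0"
proof (rule ccontr)
  assume "l i \<noteq> 0"
  then have pos: "l j \<noteq> 0" if "j \<le> i" for j
    using partitions_antimono[OF l that] by linarith
  then have "(\<Sum>j\<le>i. 1) \<le> (\<Sum>j\<le>i. l j)"
    by (intro sum_mono) (simp add: Suc_le_eq)
  also have "\<dots> \<le> psize l"
    unfolding psize_def using l pos by (intro sum_mono2) (auto simp: partitions_def)
  finally show False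
    using i by simp
qed

lemma finite_partitions_le: "finite {l \<in> partitions. psize l \<le> n}"
proof (rule finite_subset)
  show "{l \<in> partitions. psize l \<le> n} \<subseteq>
          {l. \<forall>i. (i \<in> {..<n} \<longrightarrow> l i \<in> {..n}) \<and> (i \<notin> {..<n} \<longrightarrow> l i = 0)}"
    using part_le_psize part_eq_0 by (auto intro: order_trans)
  show "finite \<dots>"
    by (rule finite_set_of_finite_funs) auto
qed

lemma zero_partition: "(\<lambda>_. 0) \<in> partitions"
  by (auto simp: partitions_def antimono_def)

lemma psize_zero [simp]: "psize (\<lambda>_. 0) = 0"
  by (simp add: psize_def)

lemma psize_mono:
  assumes "l \<in> partitions" "\<And>i. m i \<le> l i"
  shows "psize m \<le> psize l"
proof -
  obtain N where N: "\<And>i. i \<ge> N \<Longrightarrow> l i = 0"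
    using partitions_bounded assms(1) by blast
  then have "\<And>i. i \<ge> N \<Longrightarrow> m i = 0"
    using assms(2) by (metis le_zero_eq)
  then show ?thesis
    using N assms(2) by (simp add: psize_eq_sum[of N] sum_mono)
qed

lemma psize_upd:
  assumes "l \<in> partitions"
  shows "psize (l(i := v)) + l i = psize l + v"
proof -
  obtain N where N: "\<And>i. i \<ge> N \<Longrightarrow> l i = 0"
    using partitions_bounded assms by blast
  let ?M = "max N (Suc i)"
  have "psize (l(i := v)) = (\<Sum>j<?M. (l(i := v)) j)" "psize l = (\<Sum>j<?M. l j)"
    by (rule psize_eq_sum, use N in simp)+
  then show ?thesis
    by (simp add: sum.remove[of "{..<?M}" i])
qed

text \<open>Cutting the \<open>n\<close>-th coefficient at size \<open>n\<close> makes it a finite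
  sum. For a \<open>graded\<close> \<open>f\<close> the omitted terms vanish there, so this is the
  sum over all partitions.\<close>

definition psum :: "((nat \<Rightarrow> nat) \<Rightarrow> 'a::comm_ring_1 fps) \<Rightarrow> 'a fps" where
  "psum f = Abs_fps (\<lambda>n. \<Sum>l | l \<in> partitions \<and> psize l \<le> n. f l $ n)"

definition graded :: "((nat \<Rightarrow> nat) \<Rightarrow> 'a::comm_ring_1 fps) \<Rightarrow> bool" where
  "graded f \<longleftrightarrow> (\<forall>l\<in>partitions. fps_X ^ psize l dvd f l)"

lemma psum_nth: "psum f $ n = (\<Sum>l | l \<in> partitions \<and> psize l \<le> n. f l $ n)"
  by (simp add: psum_def)

lemma fps_X_power_dvd_nth: "fps_X ^ k dvd f \<Longrightarrow> n < k \<Longrightarrow> (f :: 'a::comm_ring_1 fps) $ n = 0"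
  by (auto simp: fps_X_power_mult_nth elim!: dvdE)

lemma graded_nth:
  assumes "graded f" "l \<in> partitions" "n < psize l"
  shows "f l $ n = 0"
  using assms fps_X_power_dvd_nth unfolding graded_def by metis

lemma psum_cong: "(\<And>l. l \<in> partitions \<Longrightarrow> f l = g l) \<Longrightarrow> psum f = psum g"
  by (simp add: psum_def)

lemma psum_diff: "psum (\<lambda>l. f l - g l) = psum f - psum g"
  by (rule fps_ext) (simp add: psum_nth sum_subtractf)

text \<open>Both orders let \<open>l\<close> and \<open>m\<close> range over sizes up to the same
  \<open>n\<close>, so this is an exchange of finite sums.\<close>

lemma psum_swap: "psum (\<lambda>l. psum (\<lambda>m. f l m)) = psum (\<lambda>m. psum (\<lambda>l. f l m))"
  by (rule fps_ext) (unfold psum_nth, rule sum.swap)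

lemma psum_eq_sum:
  assumes "finite A" "A \<subseteq> partitions" "\<And>l. l \<in> partitions \<Longrightarrow> l \<notin> A \<Longrightarrow> f l = 0" "graded f"
  shows "psum f = sum f A"
proof (rule fps_ext)
  fix n
  show "psum f $ n = sum f A $ n"
    unfolding psum_nth fps_sum_nth using assms finite_partitions_le[of n]
    by (intro sum.mono_neutral_cong) (auto simp: graded_nth not_le)
qed

lemma psum_mult_left:
  assumes "graded f"
  shows "psum (\<lambda>l. c * f l) = c * psum f"
proof (rule fps_ext)
  fix n
  have "psum (\<lambda>l. c * f l) $ n =
        (\<Sum>l | l \<in> partitions \<and> psize l \<le> n. \<Sum>i=0..n. c $ i * f l $ (n - i))"
    by (simp add: psum_nth fps_mult_nth)
  also have "\<dots> = (\<Sum>i=0..n. \<Sum>l | l \<in> partitions \<and> psize l \<le> n. c $ i * f l $ (n - i))"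
    by (rule sum.swap)
  \<comment> \<open>Sizes above \<open>n - i\<close> contribute nothing to the coefficient
    \<open>n - i\<close>, because \<open>f\<close> is graded.\<close>
  also have "\<dots> = (\<Sum>i=0..n. c $ i * psum f $ (n - i))"
    unfolding psum_nth sum_distrib_left
    by (rule sum.cong[OF refl], rule sum.mono_neutral_right[OF finite_partitions_le])
       (auto simp: not_le graded_nth[OF assms])
  finally show "psum (\<lambda>l. c * f l) $ n = (c * psum f) $ n"
    by (simp add: fps_mult_nth)
qed

text \<open>The maps are inverse to each other between the supports only; elsewhere they may even
  leave \<open>partitions\<close>. They may change sizes, so the cut-off is first replaced by the
  support of the \<open>n\<close>-th coefficient, which the maps respect.\<close>

lemma psum_reindex:
  assumes "graded f" "graded g"
    and "\<And>l. l \<in> partitions \<Longrightarrow> f l \<noteq> 0 \<Longrightarrow> h l \<in> partitions \<and> g (h l) = f l \<and> h' (h l) = l"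
    and "\<And>m. m \<in> partitions \<Longrightarrow> g m \<noteq> 0 \<Longrightarrow> h' m \<in> partitions \<and> f (h' m) = g m \<and> h (h' m) = m"
  shows "psum f = psum g"
proof (rule fps_ext)
  fix n
  let ?A = "\<lambda>f. {l \<in> partitions. f l $ n \<noteq> 0}"
  have *: "psum f $ n = (\<Sum>l\<in>?A f. f l $ n)" if "graded f" for f :: "_ \<Rightarrow> 'a fps"
    unfolding psum_nth
    by (intro sum.mono_neutral_cong_right finite_partitions_le)
       (use graded_nth[OF that, of _ n] not_le in auto)
  have "(\<Sum>l\<in>?A f. f l $ n) = (\<Sum>m\<in>?A g. g m $ n)"
    by (rule sum.reindex_bij_witness[of _ h' h]) (use assms(3,4) in \<open>force+\<close>)
  then show "psum f $ n = psum g $ n"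
    by (simp add: *[OF assms(1)] *[OF assms(2)])
qed

subsection \<open>Strips\<close>

definition hstrip :: "(nat \<Rightarrow> nat) \<Rightarrow> (nat \<Rightarrow> nat) \<Rightarrow> bool" where
  "hstrip m l \<longleftrightarrow> (\<forall>i. m i \<le> l i \<and> l (Suc i) \<le> m i)"

definition vstrip :: "(nat \<Rightarrow> nat) \<Rightarrow> (nat \<Rightarrow> nat) \<Rightarrow> bool" where
  "vstrip m l \<longleftrightarrow> (\<forall>i. m i \<le> l i \<and> l i \<le> Suc (m i))"

text \<open>With \<open>hstrip\<close> and \<open>vstrip\<close> for \<open>R\<close> these are
  \<open>U z\<close> and \<open>V z\<close> of the overview; \<open>detach x\<close> is
  \<open>D x\<close>. The size difference counts the attached boxes and is not truncated, since
  either relation entails containment.\<close>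

definition attach ::
  "((nat \<Rightarrow> nat) \<Rightarrow> (nat \<Rightarrow> nat) \<Rightarrow> bool) \<Rightarrow> 'a::comm_ring_1 fps \<Rightarrow>
   ((nat \<Rightarrow> nat) \<Rightarrow> 'a fps) \<Rightarrow> (nat \<Rightarrow> nat) \<Rightarrow> 'a fps" where
  "attach R z f l = psum (\<lambda>m. if R m l then z ^ (psize l - psize m) * f m else 0)"

definition detach :: "'a::comm_ring_1 fps \<Rightarrow> ((nat \<Rightarrow> nat) \<Rightarrow> 'a fps) \<Rightarrow> (nat \<Rightarrow> nat) \<Rightarrow> 'a fps" where
  "detach x f l = psum (\<lambda>n. if hstrip l n then x ^ (psize n - psize l) * f n else 0)"

text \<open>Interlacing forces both sequences to decrease, so after a part has been changed only the
  interlacing has to be checked.\<close>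

lemma hstrip_partition_outer:
  assumes m: "m \<in> partitions" and "hstrip m l"
  shows "l \<in> partitions"
proof -
  obtain N where N: "\<And>i. i \<ge> N \<Longrightarrow> m i = 0"
    using partitions_bounded m by blast
  show ?thesis
  proof (rule partitionsI)
    show "l (Suc i) \<le> l i" for i
      using assms(2) by (meson hstrip_def order_trans)
    show "l i = 0" if "i \<ge> Suc N" for i
      using assms(2) N[of "i - 1"] that
      by (cases i) (auto simp: hstrip_def dest: spec[of _ "i - 1"])
  qed
qed

lemma hstrip_partition_inner:
  assumes l: "l \<in> partitions" and "hstrip m l"
  shows "m \<in> partitions"
proof -
  obtain N where N: "\<And>i. i \<ge> N \<Longrightarrow> l i = 0"
    using partitions_bounded l by blast
  show ?thesis
  proof (rule partitionsI)
    show "m (Suc i) \<le> m i" for i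
      using assms(2) by (meson hstrip_def order_trans)
    show "m i = 0" if "i \<ge> N" for i
      using assms(2) N[OF that] by (metis hstrip_def le_zero_eq)
  qed
qed

lemma hstrip_psize: "hstrip m l \<Longrightarrow> l \<in> partitions \<Longrightarrow> psize m \<le> psize l"
  by (rule psize_mono) (auto simp: hstrip_def)

lemma vstrip_psize: "vstrip m l \<Longrightarrow> l \<in> partitions \<Longrightarrow> psize m \<le> psize l"
  by (rule psize_mono) (auto simp: vstrip_def)

lemma fps_X_power_dvd_iff:
  "fps_X ^ k dvd f \<longleftrightarrow> (\<forall>n<k. (f :: 'a::comm_ring_1 fps) $ n = 0)"
proof
  assume *: "\<forall>n<k. f $ n = 0"
  have "f = fps_X ^ k * fps_shift k f"
    by (rule fps_ext) (use * in \<open>auto simp: fps_X_power_mult_nth\<close>)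
  then show "fps_X ^ k dvd f"
    by (rule dvdI)
qed (simp add: fps_X_power_dvd_nth)

lemma gradedD: "graded f \<Longrightarrow> l \<in> partitions \<Longrightarrow> fps_X ^ psize l dvd f l"
  by (simp add: graded_def)

lemma fps_X_power_dvd_le: "fps_X ^ k dvd (f :: 'a::comm_ring_1 fps) \<Longrightarrow> j \<le> k \<Longrightarrow> fps_X ^ j dvd f"
  by (meson dvd_trans le_imp_power_dvd)

lemma psum_dvd: "(\<And>l. l \<in> partitions \<Longrightarrow> fps_X ^ k dvd f l) \<Longrightarrow> fps_X ^ k dvd psum f"
  by (simp add: fps_X_power_dvd_iff psum_nth)

lemma strip_term_dvd:
  fixes z c :: "'a::comm_ring_1 fps"
  assumes "fps_X dvd z" "fps_X ^ j dvd c"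
  shows "fps_X ^ i dvd z ^ (i - j) * c"
proof -
  have "fps_X ^ (i - j) * fps_X ^ j dvd z ^ (i - j) * c"
    using assms by (intro mult_dvd_mono dvd_power_same)
  then have "fps_X ^ (i - j + j) dvd z ^ (i - j) * c"
    unfolding power_add .
  then show ?thesis
    by (rule fps_X_power_dvd_le) linarith
qed

lemma graded_attach:
  assumes "fps_X dvd z" "graded f"
  shows "graded (attach R z f)"
  unfolding graded_def attach_def
  using assms by (auto intro!: psum_dvd strip_term_dvd dest: gradedD)

text \<open>The shapes summed over contain \<open>l\<close>, so \<open>f n\<close> alone carries the
  required power of q, whatever the series \<open>x\<close> is.\<close>

lemma graded_detach:
  assumes "graded f"
  shows "graded (detach x f)"
  unfolding graded_def detach_def
proof (intro ballI psum_dvd)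
  fix l n assume "l \<in> partitions" "n \<in> partitions"
  then have "fps_X ^ psize l dvd f n" if "hstrip l n"
    using that fps_X_power_dvd_le[OF gradedD[OF assms]] hstrip_psize by metis
  then show "fps_X ^ psize l dvd (if hstrip l n then x ^ (psize n - psize l) * f n else 0)"
    by simp
qed

lemma psum_0: "psum (\<lambda>_. 0) = 0"
  by (rule fps_ext) (simp add: psum_nth)

text \<open>After a shift of the index, each \<open>i\<close> contributes its minimum through
  \<open>k\<close> and its maximum through \<open>l\<close>, together
  \<open>m i + n i\<close>.\<close>

lemma psize_reflect:
  assumes "m \<in> partitions" "n \<in> partitions" "l \<in> partitions" "k \<in> partitions"
    and l0: "l 0 = max (m 0) (n 0)"
    and lk: "\<And>i. l (Suc i) + k i = min (m i) (n i) + max (m (Suc i)) (n (Suc i))"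
  shows "psize l + psize k = psize m + psize n"
proof -
  obtain A B C D where "\<And>i. i \<ge> A \<Longrightarrow> m i = 0" "\<And>i. i \<ge> B \<Longrightarrow> n i = 0"
      "\<And>i. i \<ge> C \<Longrightarrow> l i = 0" "\<And>i. i \<ge> D \<Longrightarrow> k i = 0"
    using assms(1-4) by (metis partitions_bounded)
  moreover define N where "N = A + B + C + D"
  ultimately have z: "m i = 0" "n i = 0" "l i = 0" "k i = 0" if "i \<ge> N" for i
    using that by simp_all
  have "psize l + psize k = (\<Sum>i<Suc N. l i) + (\<Sum>i<N. k i)"
    using z by (simp add: psize_eq_sum[of N k] psize_eq_sum[of "Suc N" l])
  also have "\<dots> = l 0 + (\<Sum>i<N. l (Suc i) + k i)"
    by (simp add: sum.lessThan_Suc_shift sum.distrib del: sum.lessThan_Suc)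
  also have "\<dots> = (\<Sum>i<N. min (m i) (n i)) + (\<Sum>i<Suc N. max (m i) (n i))"
    by (simp add: l0 lk sum.lessThan_Suc_shift sum.distrib del: sum.lessThan_Suc)
  also have "\<dots> = (\<Sum>i<N. min (m i) (n i) + max (m i) (n i))"
    by (simp add: z sum.distrib)
  also have "\<dots> = (\<Sum>i<N. m i + n i)"
    by (rule sum.cong) auto
  also have "\<dots> = psize m + psize n"
    using z by (simp add: psize_eq_sum[of N] sum.distrib)
  finally show ?thesis .
qed

text \<open>
  One-variable skew Cauchy identity.  The partitions \<open>l\<close> with a prescribed first part are matched
  with the partitions \<open>k\<close> by reflecting \<open>l (Suc i)\<close> in the interval it may range over; the free
  first part contributes the geometric series \<open>1 / (1 - x * z)\<close>.
\<close>
lemma skew_cauchy: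
  fixes x z c :: "'a::comm_ring_1 fps"
  assumes m: "m \<in> partitions" and n: "n \<in> partitions"
    and z: "fps_X dvd z" and c: "fps_X ^ psize n dvd c"
  shows "(1 - x * z) * psum (\<lambda>l. if hstrip m l \<and> hstrip n l
            then x ^ (psize l - psize m) * (z ^ (psize l - psize n) * c) else 0) =
         psum (\<lambda>k. if hstrip k m \<and> hstrip k n
            then x ^ (psize n - psize k) * (z ^ (psize m - psize k) * c) else 0)"
proof -
  \<comment> \<open>\<open>l (Suc i)\<close> and \<open>k i\<close> range over the same interval,
    from \<open>M (Suc i)\<close> to \<open>N i\<close>; \<open>l 0\<close> is bounded only from
    below, by \<open>M 0\<close>.\<close>
  define M where "M i = max (m i) (n i)" for i
  define N where "N i = min (m i) (n i)" for i
  define g where "g l = (if hstrip m l \<and> hstrip n l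
    then x ^ (psize l - psize m) * (z ^ (psize l - psize n) * c) else 0)" for l
  define g0 where "g0 l = (if l 0 = M 0 then g l else 0)" for l
  define g1 where "g1 l = (if l 0 = M 0 then 0 else g l)" for l
  define r where "r k = (if hstrip k m \<and> hstrip k n
    then x ^ (psize n - psize k) * (z ^ (psize m - psize k) * c) else 0)" for k
  have g: "graded g"
    using z c by (auto simp: graded_def g_def intro!: dvd_mult[OF strip_term_dvd])
  then have g0: "graded g0" and g1: "graded g1" and xzg: "graded (\<lambda>l. x * z * g l)"
    by (auto simp: graded_def g0_def g1_def)
  have r: "graded r"
    unfolding graded_def r_def using n c fps_X_power_dvd_le[OF c] by (auto intro!: dvd_mult hstrip_psize)
  \<comment> \<open>A box added to the first row lies in both strips and so contributes
    \<open>x * z\<close>. This maps all admissible \<open>l\<close> onto those whose first part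
    exceeds the minimum \<open>M 0\<close>.\<close>
  have "psum (\<lambda>l. x * z * g l) = psum g1"
  proof (rule psum_reindex[where h = "\<lambda>l. l(0 := Suc (l 0))" and h' = "\<lambda>l. l(0 := l 0 - 1)"])
    fix l assume l: "l \<in> partitions" "x * z * g l \<noteq> 0"
    let ?l = "l(0 := Suc (l 0))"
    have s: "hstrip m l" "hstrip n l"
      using l(2) by (auto simp: g_def split: if_splits)
    then have s': "hstrip m ?l" "hstrip n ?l"
      by (auto simp: hstrip_def le_Suc_eq)
    have "psize ?l = Suc (psize l)"
      using psize_upd[OF l(1), of 0 "Suc (l 0)"] by simp
    moreover have "psize m \<le> psize l" "psize n \<le> psize l"
      using s l(1) hstrip_psize by blast+
    ultimately have "g ?l = x * z * g l"
      using s s' by (simp add: g_def Suc_diff_le mult_ac)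
    moreover have "?l 0 \<noteq> M 0"
      using s by (auto simp: M_def hstrip_def dest!: spec[of _ 0])
    ultimately show "?l \<in> partitions \<and> g1 ?l = x * z * g l \<and> ?l(0 := ?l 0 - 1) = l"
      using hstrip_partition_outer[OF m s'(1)] by (simp add: g1_def)
  next
    fix l assume l: "l \<in> partitions" "g1 l \<noteq> 0"
    let ?l = "l(0 := l 0 - 1)"
    have s: "hstrip m l" "hstrip n l" "l 0 \<noteq> M 0"
      using l(2) by (auto simp: g1_def g_def split: if_splits)
    then have gt: "m 0 < l 0" "n 0 < l 0"
      by (auto simp: M_def hstrip_def max_def dest!: spec[of _ 0] split: if_splits)
    then have s': "hstrip m ?l" "hstrip n ?l"
      using s(1,2) by (auto simp: hstrip_def)
    then have p: "?l \<in> partitions"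
      using hstrip_partition_outer m by blast
    have "psize l = Suc (psize ?l)"
      using psize_upd[OF l(1), of 0 "l 0 - 1"] gt by simp
    moreover have "psize m \<le> psize ?l" "psize n \<le> psize ?l"
      using s' p hstrip_psize by blast+
    ultimately have "g l = x * z * g ?l"
      using s s' by (simp add: g_def Suc_diff_le mult_ac)
    then show "?l \<in> partitions \<and> x * z * g ?l = g1 l \<and> ?l(0 := Suc (?l 0)) = l"
      using p s(3) gt by (simp add: g1_def)
  qed (rule xzg g1)+
  then have "(1 - x * z) * psum g = psum g - psum g1"
    by (simp only: psum_mult_left[OF g] left_diff_distrib mult_1_left)
  also have "\<dots> = psum g0"
    unfolding psum_diff[symmetric] by (rule psum_cong) (simp add: g0_def g1_def)
  also have "\<dots> = psum r"
  proof (rule psum_reindex[where h = "\<lambda>l i. N i + M (Suc i) - l (Suc i)"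
        and h' = "\<lambda>k i. case i of 0 \<Rightarrow> M 0 | Suc j \<Rightarrow> N j + M (Suc j) - k j"])
    fix l assume l: "l \<in> partitions" "g0 l \<noteq> 0"
    let ?k = "\<lambda>i. N i + M (Suc i) - l (Suc i)"
    have s: "hstrip m l" "hstrip n l" "l 0 = M 0"
      using l(2) by (auto simp: g0_def g_def split: if_splits)
    then have b: "M (Suc i) \<le> l (Suc i)" "l (Suc i) \<le> N i" for i
      by (auto simp: hstrip_def M_def N_def)
    have b': "M (Suc i) \<le> ?k i" "?k i \<le> N i" for i
      using b[of i] by linarith+
    have s': "hstrip ?k m" "hstrip ?k n"
      using b' by (auto simp: hstrip_def M_def N_def)
    have p: "?k \<in> partitions"
      using hstrip_partition_inner m s'(1) by blast
    \<comment> \<open>This balance matches the exponents: l/m has as many boxes as n/k, and l/n as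
      many as m/k.\<close>
    have "psize l + psize ?k = psize m + psize n"
    proof (rule psize_reflect[OF m n l(1) p, folded M_def N_def])
      show "l (Suc i) + ?k i = N i + M (Suc i)" for i
        using b(1)[of i] b(2)[of i] by linarith
    qed (rule s(3))
    moreover have "psize m \<le> psize l" "psize n \<le> psize l"
      using s l(1) hstrip_psize by blast+
    ultimately have "psize l - psize m = psize n - psize ?k" "psize l - psize n = psize m - psize ?k"
      by linarith+
    then have "r ?k = g0 l"
      using s s' by (simp add: g0_def g_def r_def)
    moreover have "(\<lambda>i. case i of 0 \<Rightarrow> M 0 | Suc j \<Rightarrow> N j + M (Suc j) - ?k j) = l"
    proof
      show "(case i of 0 \<Rightarrow> M 0 | Suc j \<Rightarrow> N j + M (Suc j) - ?k j) = l i" for i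
        using s(3) b[of "i - 1"] by (cases i) auto
    qed
    ultimately show "?k \<in> partitions \<and> r ?k = g0 l \<and>
        (\<lambda>i. case i of 0 \<Rightarrow> M 0 | Suc j \<Rightarrow> N j + M (Suc j) - ?k j) = l"
      using p by blast
  next
    fix k assume k: "k \<in> partitions" "r k \<noteq> 0"
    let ?l = "\<lambda>i. case i of 0 \<Rightarrow> M 0 | Suc j \<Rightarrow> N j + M (Suc j) - k j"
    have s: "hstrip k m" "hstrip k n"
      using k(2) by (auto simp: r_def split: if_splits)
    then have b: "M (Suc i) \<le> k i" "k i \<le> N i" for i
      by (auto simp: hstrip_def M_def N_def)
    have b': "M (Suc i) \<le> ?l (Suc i)" "?l (Suc i) \<le> N i" for i
      using b[of i] by simp_all
    have b'': "M i \<le> ?l i" for i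
      using b'(1) by (cases i) simp_all
    have s': "hstrip m ?l" "hstrip n ?l"
      using b'(2) b'' by (auto simp only: hstrip_def M_def N_def max.bounded_iff min.bounded_iff)
    have p: "?l \<in> partitions"
      using hstrip_partition_outer m s'(1) by blast
    have "psize ?l + psize k = psize m + psize n"
    proof (rule psize_reflect[OF m n p k(1), folded M_def N_def])
      show "?l (Suc i) + k i = N i + M (Suc i)" for i
        using b(2)[of i] by simp
    qed simp
    moreover have "psize m \<le> psize ?l" "psize n \<le> psize ?l"
      using s' p hstrip_psize by blast+
    ultimately have "psize ?l - psize m = psize n - psize k" "psize ?l - psize n = psize m - psize k"
      by linarith+
    then have "g0 ?l = r k"
      using s s' by (simp add: g0_def g_def r_def)
    moreover have "(\<lambda>i. N i + M (Suc i) - ?l (Suc i)) = k"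
    proof
      show "N i + M (Suc i) - ?l (Suc i) = k i" for i
        using b[of i] by simp
    qed
    ultimately show "?l \<in> partitions \<and> g0 ?l = r k \<and> (\<lambda>i. N i + M (Suc i) - ?l (Suc i)) = k"
      using p by blast
  qed (rule g0 r)+
  finally show ?thesis
    unfolding g_def[abs_def] r_def[abs_def] .
qed

subsection \<open>Commutation and inversion\<close>

lemma psum_mult_left_if:
  assumes "graded f"
  shows "(if P then c * psum f else 0) = psum (\<lambda>l. if P then c * f l else 0)"
  by (simp add: psum_mult_left[OF assms] psum_0)

lemma graded_if: "graded f \<Longrightarrow> graded (\<lambda>l. if P l then f l else 0)"
  by (simp add: graded_def)

lemma graded_mult: "graded f \<Longrightarrow> graded (\<lambda>l. c l * f l)"
  by (simp add: graded_def)

text \<open>For fixed \<open>l\<close> and \<open>m\<close>, the coefficients of \<open>f m\<close>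
  are sums over the shapes around both and over the shapes inside both, as compared by
  \<open>skew_cauchy\<close>. There \<open>f m\<close> itself is passed as \<open>c\<close>, so that
  its divisibility keeps the terms graded.\<close>

lemma detach_attach:
  fixes x z :: "'a::comm_ring_1 fps"
  assumes z: "fps_X dvd z" and f: "graded f" and l: "l \<in> partitions"
  shows "(1 - x * z) * detach x (attach hstrip z f) l = attach hstrip z (detach x f) l"
proof -
  define T where "T m n = (if hstrip l n \<and> hstrip m n
    then x ^ (psize n - psize l) * (z ^ (psize n - psize m) * f m) else 0)" for m n
  define U where "U m k = (if hstrip k l \<and> hstrip k m
    then x ^ (psize m - psize k) * (z ^ (psize l - psize k) * f m) else 0)" for m k
  have "detach x (attach hstrip z f) l = psum (\<lambda>n. psum (\<lambda>m. T m n))"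
    unfolding detach_def attach_def T_def
    by (simp add: psum_mult_left_if f graded_if graded_mult if_distrib[of "\<lambda>a. _ * a"]
        cong: if_cong) (auto intro!: psum_cong)
  also have "\<dots> = psum (\<lambda>m. psum (T m))"
    by (rule psum_swap)
  finally have "(1 - x * z) * detach x (attach hstrip z f) l = (1 - x * z) * psum (\<lambda>m. psum (T m))"
    by simp
  also have "\<dots> = psum (\<lambda>m. (1 - x * z) * psum (T m))"
  proof (rule psum_mult_left[symmetric])
    show "graded (\<lambda>m. psum (T m))"
      unfolding graded_def T_def using f by (auto intro!: psum_dvd dvd_mult dest: gradedD)
  qed
  also have "\<dots> = psum (\<lambda>m. psum (U m))"
    unfolding T_def[abs_def] U_def[abs_def]
    by (rule psum_cong) (rule skew_cauchy[OF l _ z], use f in \<open>auto dest: gradedD\<close>)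
  also have "\<dots> = psum (\<lambda>k. psum (\<lambda>m. U m k))"
    by (rule psum_swap)
  also have "\<dots> = attach hstrip z (detach x f) l"
    unfolding detach_def attach_def U_def
    by (simp add: psum_mult_left_if f graded_if graded_mult if_distrib[of "\<lambda>a. _ * a"]
        cong: if_cong) (auto intro!: psum_cong simp: mult_ac)
  finally show ?thesis .
qed

text \<open>This is \<open>skew_cauchy\<close> for two equal partitions with one variable set to 1:
  strips around \<open>m\<close> are compared with strips inside \<open>m\<close>.\<close>

lemma psum_attach_hstrip:
  fixes x :: "'a::comm_ring_1 fps"
  assumes x: "fps_X dvd x" and f: "graded f"
  shows "(1 - x) * psum (attach hstrip x f) = psum (detach x f)"
proof -
  define T where "T m n = (if hstrip m n then x ^ (psize n - psize m) * f m else 0)" for m n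
  have "psum (attach hstrip x f) = psum (\<lambda>n. psum (\<lambda>m. T m n))"
    by (simp add: attach_def[abs_def] T_def)
  also have "\<dots> = psum (\<lambda>m. psum (T m))"
    by (rule psum_swap)
  finally have "(1 - x) * psum (attach hstrip x f) = (1 - x) * psum (\<lambda>m. psum (T m))"
    by simp
  also have "\<dots> = psum (\<lambda>m. (1 - x) * psum (T m))"
  proof (rule psum_mult_left[symmetric])
    show "graded (\<lambda>m. psum (T m))"
      unfolding graded_def T_def using f by (auto intro!: psum_dvd dvd_mult dest: gradedD)
  qed
  also have "\<dots> = psum (\<lambda>m. psum (\<lambda>k. if hstrip k m then x ^ (psize m - psize k) * f m else 0))"
  proof (rule psum_cong)
    fix m assume m: "m \<in> partitions"
    show "(1 - x) * psum (T m) = psum (\<lambda>k. if hstrip k m then x ^ (psize m - psize k) * f m else 0)"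
      using skew_cauchy[OF m m x gradedD[OF f m], of 1] by (simp add: T_def[abs_def] cong: if_cong)
  qed
  also have "\<dots> = psum (detach x f)"
    unfolding detach_def[abs_def] by (rule psum_swap)
  finally show ?thesis .
qed

text \<open>Toggling part \<open>i\<close> reverses the sign. The two halves are matched with each
  other; to show that the sum equals its own negative would say nothing in characteristic 2.\<close>

lemma psum_cancel:
  assumes f: "graded f"
    and i: "\<And>l. l \<in> partitions \<Longrightarrow> f l \<noteq> 0 \<Longrightarrow> l i = p \<or> l i = Suc p"
    and up: "\<And>l. l \<in> partitions \<Longrightarrow> f l \<noteq> 0 \<Longrightarrow> l i = p \<Longrightarrow>
               l(i := Suc p) \<in> partitions \<and> f (l(i := Suc p)) = - f l"
    and down: "\<And>l. l \<in> partitions \<Longrightarrow> f l \<noteq> 0 \<Longrightarrow> l i = Suc p \<Longrightarrow>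
               l(i := p) \<in> partitions \<and> f (l(i := p)) = - f l"
  shows "psum f = 0"
proof -
  let ?f = "\<lambda>l. if l i = p then f l else 0" and ?g = "\<lambda>l. if l i = Suc p then - f l else 0"
  have "graded ?f" "graded ?g"
    using f by (auto simp: graded_def)
  then have "psum ?f = psum ?g"
    by (rule psum_reindex[where h = "\<lambda>l. l(i := Suc p)" and h' = "\<lambda>l. l(i := p)"])
       (use up down in \<open>auto split: if_splits\<close>)
  moreover have "psum f = psum (\<lambda>l. ?f l - ?g l)"
    by (rule psum_cong) (use i in force)
  ultimately show ?thesis
    by (simp add: psum_diff)
qed

text \<open>
  Intermediate partitions that differ by one box contribute opposite signs and cancel.
\<close>
lemma attach_inverse:
  fixes y :: "'a::comm_ring_1 fps"
  assumes le: "\<And>m l i. R m l \<Longrightarrow> m i \<le> l i" "\<And>m l i. S m l \<Longrightarrow> m i \<le> l i"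
    and refl: "\<And>l. l \<in> partitions \<Longrightarrow> R l l \<and> S l l"
    and pairs: "\<And>l m. l \<in> partitions \<Longrightarrow> m \<in> partitions \<Longrightarrow> m \<noteq> l \<Longrightarrow> (\<And>i. m i \<le> l i) \<Longrightarrow>
      \<exists>i p. \<forall>n\<in>partitions. R n l \<longrightarrow> S m n \<longrightarrow> (n i = p \<or> n i = Suc p) \<and>
        (\<forall>v. v = p \<or> v = Suc p \<longrightarrow> n(i := v) \<in> partitions \<and> R (n(i := v)) l \<and> S m (n(i := v)))"
    and y: "fps_X dvd y" and f: "graded f" and l: "l \<in> partitions"
  shows "attach R (- y) (attach S y f) l = f l"
proof -
  define K where "K m n = (if R n l \<and> S m n
    then (- y) ^ (psize l - psize n) * (y ^ (psize n - psize m) * f m) else 0)" for m n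
  have size: "R m n \<Longrightarrow> n \<in> partitions \<Longrightarrow> psize m \<le> psize n"
      "S m n \<Longrightarrow> n \<in> partitions \<Longrightarrow> psize m \<le> psize n" for m n
    using le psize_mono by blast+
  have K: "graded (K m)" if "m \<in> partitions" for m
    using y f that by (auto simp: graded_def K_def intro!: dvd_mult[OF strip_term_dvd])
  have inner: "psum (K m) = (if m = l then f l else 0)" if m: "m \<in> partitions" for m
  proof (cases "m = l")
    case True
    have "K m n = 0" if "n \<noteq> l" for n
    proof -
      have "n = l" if "R n l" "S l n"
        using le(1)[OF that(1)] le(2)[OF that(2)] by (intro ext antisym)
      then show ?thesis
        using that True by (auto simp: K_def)
    qed
    then have "psum (K m) = sum (K m) {l}"
      by (intro psum_eq_sum K m) (use l in auto)
    then show ?thesis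
      using True refl l by (simp add: K_def)
  next
    case neq: False
    show ?thesis
    proof (cases "\<forall>i. m i \<le> l i")
      case True
      \<comment> \<open>Row \<open>i\<close> and length \<open>p\<close> depend on \<open>l\<close>
        and \<open>m\<close> only, not on the intermediate \<open>n\<close>; this makes toggling the
        box an involution.\<close>
      then obtain i p where ip: "n i = p \<or> n i = Suc p"
          "v = p \<or> v = Suc p \<Longrightarrow> n(i := v) \<in> partitions \<and> R (n(i := v)) l \<and> S m (n(i := v))"
        if "n \<in> partitions" "R n l" "S m n" for n v
        using pairs[OF l m neq] by metis
      have RS: "R n l" "S m n" if "K m n \<noteq> 0" for n
        using that by (auto simp: K_def split: if_splits)
      have flip: "K m (n(i := Suc p)) = - K m n"
        if n: "n \<in> partitions" "R n l" "S m n" "n i = p" for n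
      proof -
        let ?n = "n(i := Suc p)"
        have n': "?n \<in> partitions" "R ?n l" "S m ?n"
          using ip(2)[OF n(1-3), of "Suc p"] by auto
        have "psize ?n = Suc (psize n)"
          using psize_upd[OF n(1), of i "Suc p"] n(4) by simp
        moreover have "psize m \<le> psize n" "psize ?n \<le> psize l"
          using size n n' l by blast+
        ultimately have "psize l - psize n = Suc (psize l - psize ?n)"
            "psize ?n - psize m = Suc (psize n - psize m)"
          by linarith+
        then show ?thesis
          using n n' by (simp add: K_def mult_ac)
      qed
      have "psum (K m) = 0"
      proof (rule psum_cancel[OF K[OF m]])
        fix n assume n: "n \<in> partitions" "K m n \<noteq> 0"
        show "n i = p \<or> n i = Suc p"
          using ip(1) n RS by blast
        show "n(i := Suc p) \<in> partitions \<and> K m (n(i := Suc p)) = - K m n" if "n i = p"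
          using ip(2)[OF n(1) RS[OF n(2)], of "Suc p"] flip[OF n(1) RS[OF n(2)] that] by blast
        show "n(i := p) \<in> partitions \<and> K m (n(i := p)) = - K m n" if "n i = Suc p"
        proof -
          have n': "n(i := p) \<in> partitions" "R (n(i := p)) l" "S m (n(i := p))"
            using ip(2)[OF n(1) RS[OF n(2)], of p] by auto
          have "(n(i := p))(i := Suc p) = n"
            using that by auto
          then show ?thesis
            using flip[OF n'] n'(1) by simp
        qed
      qed
      then show ?thesis
        using neq by simp
    next
      case False
      then have "\<not> (R n l \<and> S m n)" for n
        using le(1)[of n l] le(2)[of m n] order_trans by metis
      then have "K m = (\<lambda>_. 0)"
        unfolding K_def by (auto simp: fun_eq_iff)
      then show ?thesis
        using neq by (simp add: psum_0)
    qed
  qed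
  have "attach R (- y) (attach S y f) l = psum (\<lambda>n. psum (\<lambda>m. K m n))"
    unfolding attach_def K_def
    by (simp add: psum_mult_left_if f graded_if graded_mult if_distrib[of "\<lambda>a. _ * a"]
        cong: if_cong) (auto intro!: psum_cong)
  also have "\<dots> = psum (\<lambda>m. psum (K m))"
    by (rule psum_swap)
  also have "\<dots> = psum (\<lambda>m. if m = l then f l else 0)"
    by (rule psum_cong) (rule inner)
  also have "\<dots> = sum (\<lambda>m. if m = l then f l else 0) {l}"
    by (rule psum_eq_sum) (use l f in \<open>auto simp: graded_def\<close>)
  finally show ?thesis
    by simp
qed

lemma hstrip_refl: "l \<in> partitions \<Longrightarrow> hstrip l l"
  using partitions_antimono by (auto simp: hstrip_def)

lemma attach_hstrip_vstrip:
  fixes y :: "'a::comm_ring_1 fps"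
  assumes "fps_X dvd y" "graded f" "l \<in> partitions"
  shows "attach hstrip (- y) (attach vstrip y f) l = f l"
proof (rule attach_inverse[OF _ _ _ _ assms])
  fix l m :: "nat \<Rightarrow> nat"
  assume l: "l \<in> partitions" and m: "m \<in> partitions" and neq: "m \<noteq> l" and le: "\<And>i. m i \<le> l i"
  \<comment> \<open>In the lowest row where \<open>l\<close> exceeds \<open>m\<close>, the first box
    beyond \<open>m\<close> can go to either strip: the next row of \<open>l\<close> is that of
    \<open>m\<close>, hence no longer than \<open>m i\<close>.\<close>
  define i where "i = Max {i. m i < l i}"
  have "finite {i. m i < l i}"
    by (rule finite_subset[of _ "{i. l i \<noteq> 0}"]) (use l in \<open>auto simp: partitions_def\<close>)
  moreover have "{i. m i < l i} \<noteq> {}"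
    using neq le by (auto simp: fun_eq_iff intro!: le_neq_implies_less)
  ultimately have i: "m i < l i" "\<And>j. m j < l j \<Longrightarrow> j \<le> i"
    unfolding i_def using Max_in[of "{i. m i < l i}"] by auto
  have Suc_i: "l (Suc i) \<le> m i"
  proof -
    have "l (Suc i) \<le> m (Suc i)"
      using i(2)[of "Suc i"] by (meson Suc_n_not_le_n not_less)
    also have "\<dots> \<le> m i"
      using partitions_antimono[OF m] by simp
    finally show ?thesis .
  qed
  show "\<exists>i p. \<forall>n\<in>partitions. hstrip n l \<longrightarrow> vstrip m n \<longrightarrow> (n i = p \<or> n i = Suc p) \<and>
    (\<forall>v. v = p \<or> v = Suc p \<longrightarrow> n(i := v) \<in> partitions \<and> hstrip (n(i := v)) l \<and> vstrip m (n(i := v)))"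
  proof (rule exI[of _ i], rule exI[of _ "m i"], intro ballI impI conjI allI)
    fix n assume n: "hstrip n l" "vstrip m n"
    show "n i = m i \<or> n i = Suc (m i)"
      using n(2) by (auto simp: vstrip_def dest!: spec[of _ i])
    fix v assume v: "v = m i \<or> v = Suc (m i)"
    show h: "hstrip (n(i := v)) l"
      using n(1) v i(1) Suc_i by (auto simp: hstrip_def)
    show "n(i := v) \<in> partitions"
      by (rule hstrip_partition_inner[OF l h])
    show "vstrip m (n(i := v))"
      using n(2) v by (auto simp: vstrip_def)
  qed
qed (use hstrip_refl in \<open>auto simp: hstrip_def vstrip_def\<close>)

text \<open>In infinite rank a one-sided inverse need not be two-sided, and
  \<open>eigenvector_attach_vstrip\<close> uses both orders.\<close>

lemma attach_vstrip_hstrip: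
  fixes y :: "'a::comm_ring_1 fps"
  assumes "fps_X dvd y" "graded f" "l \<in> partitions"
  shows "attach vstrip y (attach hstrip (- y) f) l = f l"
proof -
  have "attach vstrip (- (- y)) (attach hstrip (- y) f) l = f l"
  proof (rule attach_inverse[OF _ _ _ _ _ assms(2,3)])
    fix l m :: "nat \<Rightarrow> nat"
    assume l: "l \<in> partitions" and m: "m \<in> partitions" and neq: "m \<noteq> l" and le: "\<And>i. m i \<le> l i"
    \<comment> \<open>In the highest row where \<open>l\<close> exceeds \<open>m\<close>, the last
      box of \<open>l\<close> can go to either strip: the row above is the same in both, hence long
      enough to cover it.\<close>
    define i where "i = (LEAST i. m i < l i)"
    have "\<exists>i. m i < l i"
      using neq le by (auto simp: fun_eq_iff intro!: le_neq_implies_less)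
    then have i: "m i < l i" and less: "\<And>j. j < i \<Longrightarrow> m j = l j"
      unfolding i_def using le by (auto intro: LeastI_ex dest!: not_less_Least simp: not_less antisym)
    have prev: "l i \<le> m j" if "Suc j = i" for j
      using less[of j] that partitions_antimono[OF l, of j i] by simp
    show "\<exists>i p. \<forall>n\<in>partitions. vstrip n l \<longrightarrow> hstrip m n \<longrightarrow> (n i = p \<or> n i = Suc p) \<and>
      (\<forall>v. v = p \<or> v = Suc p \<longrightarrow> n(i := v) \<in> partitions \<and> vstrip (n(i := v)) l \<and> hstrip m (n(i := v)))"
    proof (rule exI[of _ i], rule exI[of _ "l i - 1"], intro ballI impI conjI allI)
      fix n assume n: "vstrip n l" "hstrip m n"
      show "n i = l i - 1 \<or> n i = Suc (l i - 1)"
        using n(1) i by (auto simp: vstrip_def dest!: spec[of _ i])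
      fix v assume "v = l i - 1 \<or> v = Suc (l i - 1)"
      then have v: "m i \<le> v" "v \<le> l i" "l i \<le> Suc v"
        using i by auto
      show h: "hstrip m (n(i := v))"
        using n(2) v prev le_trans by (fastforce simp: hstrip_def)
      show "n(i := v) \<in> partitions"
        by (rule hstrip_partition_outer[OF m h])
      show "vstrip (n(i := v)) l"
        using n(1) v by (auto simp: vstrip_def)
    qed
  qed (use hstrip_refl assms in \<open>auto simp: hstrip_def vstrip_def\<close>)
  then show ?thesis
    by simp
qed

subsection \<open>Eigenvectors\<close>

lemma attach_cong:
  "(\<And>m. m \<in> partitions \<Longrightarrow> f m = g m) \<Longrightarrow> attach R z f l = attach R z g l"
  unfolding attach_def by (rule psum_cong) simp

lemma detach_cong:
  "(\<And>m. m \<in> partitions \<Longrightarrow> f m = g m) \<Longrightarrow> detach x f l = detach x g l"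
  unfolding detach_def by (rule psum_cong) simp

lemma attach_scale:
  assumes "graded f"
  shows "attach R z (\<lambda>m. c * f m) l = c * attach R z f l"
proof -
  have "attach R z (\<lambda>m. c * f m) l = psum (\<lambda>m. c * (if R m l then z ^ (psize l - psize m) * f m else 0))"
    unfolding attach_def by (rule psum_cong) (simp add: mult_ac)
  then show ?thesis
    unfolding attach_def by (simp add: psum_mult_left graded_if graded_mult assms)
qed

definition eigenvector :: "((nat \<Rightarrow> nat) \<Rightarrow> 'a::comm_ring_1 fps) \<Rightarrow> ('a fps \<Rightarrow> 'a fps) \<Rightarrow> bool" where
  "eigenvector w c \<longleftrightarrow> graded w \<and> (\<forall>x. \<forall>l\<in>partitions. detach x w l = c x * w l)"

lemma eigenvector_cong:
  assumes "eigenvector w c" "\<And>l. l \<in> partitions \<Longrightarrow> v l = w l"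
  shows "eigenvector v c"
  using assms detach_cong[OF assms(2)] by (simp add: eigenvector_def graded_def)

text \<open>Only the empty shape contributes, and it contains no shape but itself.\<close>

lemma eigenvector_vacuum: "eigenvector (\<lambda>l. if l = (\<lambda>_. 0) then 1 else 0) (\<lambda>_. 1)"
proof -
  let ?v = "\<lambda>l::nat \<Rightarrow> nat. if l = (\<lambda>_. 0) then 1 :: 'a fps else 0"
  have v: "graded ?v"
    by (simp add: graded_def)
  have "detach x ?v l = ?v l" if l: "l \<in> partitions" for x l
  proof -
    let ?f = "\<lambda>n. if hstrip l n then x ^ (psize n - psize l) * ?v n else 0"
    have "detach x ?v l = sum ?f {\<lambda>_. 0}"
      unfolding detach_def by (rule psum_eq_sum) (auto simp: v graded_if graded_mult zero_partition)
    moreover have "hstrip l (\<lambda>_. 0) \<longleftrightarrow> l = (\<lambda>_. 0)"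
      by (auto simp: hstrip_def fun_eq_iff)
    ultimately show ?thesis
      by simp
  qed
  then show ?thesis
    using v by (simp add: eigenvector_def)
qed

lemma one_minus_unit:
  fixes y :: "'a::field fps"
  assumes "fps_X dvd y"
  shows "inverse (1 - y) * (1 - y) = 1"
proof (rule inverse_mult_eq_1)
  show "(1 - y) $ 0 \<noteq> 0"
    using fps_X_power_dvd_nth[of 1 y 0] assms by simp
qed

lemma eigenvector_attach_hstrip:
  fixes z :: "'a::field fps"
  assumes w: "eigenvector w c" and z: "fps_X dvd z"
  shows "eigenvector (attach hstrip z w) (\<lambda>x. c x * inverse (1 - x * z))"
  unfolding eigenvector_def
proof (intro conjI allI ballI)
  have g: "graded w"
    using w by (simp add: eigenvector_def)
  show "graded (attach hstrip z w)"
    using z g by (rule graded_attach)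
  fix x l assume l: "l \<in> partitions"
  have "(1 - x * z) * detach x (attach hstrip z w) l = attach hstrip z (detach x w) l"
    by (rule detach_attach[OF z g l])
  also have "\<dots> = attach hstrip z (\<lambda>m. c x * w m) l"
    by (rule attach_cong) (use w in \<open>simp add: eigenvector_def\<close>)
  also have "\<dots> = c x * attach hstrip z w l"
    by (rule attach_scale[OF g])
  finally have "inverse (1 - x * z) * (1 - x * z) * detach x (attach hstrip z w) l =
      inverse (1 - x * z) * (c x * attach hstrip z w l)"
    by (simp only: mult.assoc)
  then show "detach x (attach hstrip z w) l = c x * inverse (1 - x * z) * attach hstrip z w l"
    unfolding one_minus_unit[OF dvd_mult[OF z]] by (simp add: mult_ac)
qed

text \<open>
  Attaching vertical strips inverts attaching horizontal strips of opposite sign, so its commutation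
  with \<^const>\<open>detach\<close> follows from that of horizontal strips.
\<close>
lemma eigenvector_attach_vstrip:
  fixes y :: "'a::comm_ring_1 fps"
  assumes w: "eigenvector w c" and y: "fps_X dvd y"
  shows "eigenvector (attach vstrip y w) (\<lambda>x. c x * (1 + x * y))"
  unfolding eigenvector_def
proof (intro conjI allI ballI)
  have g: "graded w"
    using w by (simp add: eigenvector_def)
  define f where "f = attach vstrip y w"
  have f: "graded f"
    unfolding f_def using y g by (rule graded_attach)
  then show "graded (attach vstrip y w)"
    by (simp add: f_def)
  fix x l assume l: "l \<in> partitions"
  have "attach hstrip (- y) (detach x f) m = (1 + x * y) * c x * w m" if m: "m \<in> partitions" for m
  proof -
    have "attach hstrip (- y) (detach x f) m = (1 - x * - y) * detach x (attach hstrip (- y) f) m"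
      by (rule detach_attach[symmetric]) (use y f m in auto)
    also have "detach x (attach hstrip (- y) f) m = detach x w m"
      unfolding f_def by (intro detach_cong attach_hstrip_vstrip y g)
    also have "\<dots> = c x * w m"
      using w m by (simp add: eigenvector_def)
    finally show ?thesis
      by (simp add: mult_ac)
  qed
  then have "attach vstrip y (attach hstrip (- y) (detach x f)) l =
      attach vstrip y (\<lambda>m. (1 + x * y) * c x * w m) l"
    by (rule attach_cong)
  also have "\<dots> = c x * (1 + x * y) * attach vstrip y w l"
    unfolding attach_scale[OF g] by (simp add: mult_ac)
  finally show "detach x (attach vstrip y w) l = c x * (1 + x * y) * attach vstrip y w l"
    unfolding attach_vstrip_hstrip[OF y graded_detach[OF f] l] by (simp add: f_def)
qed

lemma psum_attach_hstrip_eigenvector: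
  fixes x :: "'a::field fps"
  assumes w: "eigenvector w c" and x: "fps_X dvd x"
  shows "psum (attach hstrip x w) = inverse (1 - x) * c x * psum w"
proof -
  have g: "graded w"
    using w by (simp add: eigenvector_def)
  have "(1 - x) * psum (attach hstrip x w) = psum (\<lambda>l. c x * w l)"
    unfolding psum_attach_hstrip[OF x g] by (rule psum_cong) (use w in \<open>simp add: eigenvector_def\<close>)
  then have "inverse (1 - x) * (1 - x) * psum (attach hstrip x w) = inverse (1 - x) * (c x * psum w)"
    by (simp only: psum_mult_left[OF g] mult.assoc)
  then show ?thesis
    using x by (simp add: one_minus_unit mult.assoc)
qed

text \<open>The sum formula for horizontal strips is applied at \<open>- y\<close> to
  \<open>attach vstrip y w\<close>. The eigenvalue there contains 1 - y^2, and its factor 1 + y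
  cancels against that of the sum formula. The result is stated as a product, since nothing is known
  about the invertibility of \<open>c (- y)\<close>.\<close>

lemma psum_attach_vstrip_eigenvector:
  fixes y :: "'a::field fps"
  assumes w: "eigenvector w c" and y: "fps_X dvd y"
  shows "(1 - y) * c (- y) * psum (attach vstrip y w) = psum w"
proof -
  have g: "graded w"
    using w by (simp add: eigenvector_def)
  define f where "f = attach vstrip y w"
  have f: "eigenvector f (\<lambda>x. c x * (1 + x * y))"
    unfolding f_def using w y by (rule eigenvector_attach_vstrip)
  have gf: "graded f"
    using f by (simp add: eigenvector_def)
  have "(1 + y) * psum w = (1 - - y) * psum (attach hstrip (- y) f)"
    unfolding f_def using attach_hstrip_vstrip[OF y g] by (simp cong: psum_cong)
  also have "\<dots> = psum (detach (- y) f)"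
    by (rule psum_attach_hstrip) (use y gf in auto)
  also have "\<dots> = psum (\<lambda>l. c (- y) * (1 + - y * y) * f l)"
    by (rule psum_cong) (use f in \<open>simp add: eigenvector_def\<close>)
  also have "\<dots> = (1 + y) * ((1 - y) * c (- y) * psum f)"
    unfolding psum_mult_left[OF gf] by (simp add: algebra_simps)
  finally have "(1 + y) * psum w = (1 + y) * ((1 - y) * c (- y) * psum f)" .
  moreover have "1 + y \<noteq> 0"
    using fps_X_power_dvd_nth[of 1 y 0] y by (metis add.right_neutral fps_add_nth fps_one_nth
        fps_zero_nth less_one one_neq_zero power_one_right)
  ultimately show ?thesis
    by (simp add: f_def)
qed

subsection \<open>Tableaux\<close>

definition diagram :: "(nat \<Rightarrow> nat) \<Rightarrow> (nat \<times> nat) set" where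
  "diagram l = {(i, j). j < l i}"

lemma
  assumes "l \<in> partitions"
  shows finite_diagram: "finite (diagram l)" and card_diagram: "card (diagram l) = psize l"
proof -
  have "diagram l = (SIGMA i:{i. l i \<noteq> 0}. {..<l i})"
    by (auto simp: diagram_def)
  then show "finite (diagram l)" "card (diagram l) = psize l"
    using assms by (simp_all add: partitions_def psize_def card_SigmaI)
qed

text \<open>
  An entry \<open>k\<close> of a plane overpartition is encoded as \<open>2 * k\<close> if it is not overlined and as
  \<open>2 * k - 1\<close> if it is, and 0 stands for a cell outside the diagram.
\<close>
definition tableaux :: "nat set \<Rightarrow> (nat \<Rightarrow> nat) \<Rightarrow> (nat \<Rightarrow> nat \<Rightarrow> nat) set" where
  "tableaux L l = {T. (\<forall>i j. T i j \<noteq> 0 \<longleftrightarrow> j < l i) \<and> (\<forall>i j. j < l i \<longrightarrow> T i j \<in> L) \<and>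
     (\<forall>i j. T i (Suc j) \<le> T i j) \<and> (\<forall>i j. T (Suc i) j \<le> T i j) \<and>
     (\<forall>i j. odd (T i j) \<longrightarrow> T i (Suc j) \<noteq> T i j) \<and>
     (\<forall>i j. j < l i \<longrightarrow> even (T i j) \<longrightarrow> T (Suc i) j \<noteq> T i j)}"

text \<open>An even letter occurs at most once in a column, an odd one at most once in a row. As
  \<open>2 * k - 1\<close> is below \<open>2 * k\<close>, the overlined copies of \<open>k\<close>
  come after the others in both directions.\<close>

definition strip :: "nat \<Rightarrow> (nat \<Rightarrow> nat) \<Rightarrow> (nat \<Rightarrow> nat) \<Rightarrow> bool" where
  "strip t = (if even t then hstrip else vstrip)"

text \<open>Rows decrease to the 0 outside the diagram, so this counts the entries of row
  \<open>i\<close> above \<open>t\<close>.\<close>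

definition inner_shape :: "nat \<Rightarrow> (nat \<Rightarrow> nat \<Rightarrow> nat) \<Rightarrow> nat \<Rightarrow> nat" where
  "inner_shape t T i = (LEAST j. T i j \<le> t)"

definition restrict_cells :: "(nat \<Rightarrow> nat) \<Rightarrow> (nat \<Rightarrow> nat \<Rightarrow> nat) \<Rightarrow> nat \<Rightarrow> nat \<Rightarrow> nat" where
  "restrict_cells m T i j = (if j < m i then T i j else 0)"

definition extend :: "nat \<Rightarrow> (nat \<Rightarrow> nat) \<Rightarrow> (nat \<Rightarrow> nat) \<Rightarrow> (nat \<Rightarrow> nat \<Rightarrow> nat) \<Rightarrow> nat \<Rightarrow> nat \<Rightarrow> nat" where
  "extend t l m T i j = (if j < m i then T i j else if j < l i then t else 0)"

lemma finite_tableaux: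
  assumes "finite L" "l \<in> partitions"
  shows "finite (tableaux L l)"
proof -
  let ?c = "\<lambda>T :: nat \<Rightarrow> nat \<Rightarrow> nat. case_prod T"
  have "?c ` tableaux L l \<subseteq> {f. \<forall>x. (x \<in> diagram l \<longrightarrow> f x \<in> L) \<and> (x \<notin> diagram l \<longrightarrow> f x = 0)}"
    by (auto simp: tableaux_def diagram_def)
  then have "finite (?c ` tableaux L l)"
    by (rule finite_subset) (rule finite_set_of_finite_funs[OF finite_diagram[OF assms(2)] assms(1)])
  moreover have "inj ?c"
    by (auto simp: inj_def fun_eq_iff)
  ultimately show ?thesis
    by (meson finite_imageD inj_on_subset subset_UNIV)
qed

lemma tableauxD:
  assumes "T \<in> tableaux L l"
  shows "T i j \<noteq> 0 \<longleftrightarrow> j < l i" "j < l i \<Longrightarrow> T i j \<in> L"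
    "j \<le> j' \<Longrightarrow> T i j' \<le> T i j" "i \<le> i' \<Longrightarrow> T i' j \<le> T i j"
    "odd (T i j) \<Longrightarrow> T i (Suc j) \<noteq> T i j"
    "j < l i \<Longrightarrow> even (T i j) \<Longrightarrow> T (Suc i) j \<noteq> T i j"
  using assms lift_Suc_antimono_le[of "T i" j j'] lift_Suc_antimono_le[of "\<lambda>i. T i j" i i']
  by (auto simp: tableaux_def)

lemma less_inner_shape_iff:
  assumes "T \<in> tableaux L l"
  shows "j < inner_shape t T i \<longleftrightarrow> t < T i j"
proof
  show "t < T i j" if "j < inner_shape t T i"
    using not_less_Least[OF that[unfolded inner_shape_def]] by simp
  have "T i (l i) \<le> t"
    using tableauxD(1)[OF assms, of i "l i"] by simp
  then have "T i (inner_shape t T i) \<le> t"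
    unfolding inner_shape_def by (rule LeastI)
  then show "j < inner_shape t T i" if "t < T i j"
    using that tableauxD(3)[OF assms, of "inner_shape t T i" j i] by linarith
qed

text \<open>All other letters exceed \<open>t\<close>, so the cells of \<open>l\<close> outside
  \<open>m\<close> hold \<open>t\<close>. If they were no strip, two of them would be adjacent in a
  column (\<open>t\<close> even) or in a row (\<open>t\<close> odd).\<close>

lemma restrict_tableau:
  assumes t: "0 < t" "\<And>s. s \<in> L \<Longrightarrow> t < s" and l: "l \<in> partitions"
    and T: "T \<in> tableaux (insert t L) l"
  defines "m \<equiv> inner_shape t T"
  shows "m \<in> partitions" "strip t m l" "restrict_cells m T \<in> tableaux L m"
    "extend t l m (restrict_cells m T) = T"
proof -
  note D = tableauxD[OF T]
  have m: "j < m i \<longleftrightarrow> t < T i j" for i j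
    unfolding m_def using T by (rule less_inner_shape_iff)
  have Tm: "T i (m i) \<le> t" for i
    using m[of "m i" i] by simp
  have cell: "T i j = t" if "j < l i" "\<not> j < m i" for i j
    using D(2)[OF that(1)] m that(2) t(2) by auto
  have ml: "m i \<le> l i" for i
    using D(1)[of i "l i"] m[of "l i" i] by simp
  obtain N where N: "\<And>i. i \<ge> N \<Longrightarrow> l i = 0"
    using partitions_bounded l by blast
  have mS: "m (Suc i) \<le> m i" for i
    using m[of "m i" "Suc i"] D(4)[of i "Suc i" "m i"] Tm[of i] by simp
  show "m \<in> partitions"
  proof (rule partitionsI)
    show "m i = 0" if "i \<ge> N" for i
      using N[OF that] ml[of i] by simp
  qed (rule mS)
  have "l (Suc i) \<le> m i" if "even t" for i
  proof (rule ccontr)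
    assume "\<not> ?thesis"
    then have "m i < l (Suc i)" "m i < l i"
      using partitions_antimono[OF l, of i "Suc i"] by auto
    then have "T (Suc i) (m i) = t" "T i (m i) = t"
      using cell[of "m i"] mS[of i] by auto
    then show False
      using D(6)[of "m i" i] that \<open>m i < l i\<close> by simp
  qed
  moreover have "l i \<le> Suc (m i)" if "odd t" for i
  proof (rule ccontr)
    assume "\<not> ?thesis"
    then have "T i (m i) = t" "T i (Suc (m i)) = t"
      using cell[of "m i" i] cell[of "Suc (m i)" i] by auto
    then show False
      using D(5)[of i "m i"] that by simp
  qed
  ultimately show "strip t m l"
    using ml by (simp add: strip_def hstrip_def vstrip_def)
  show "restrict_cells m T \<in> tableaux L m"
    unfolding tableaux_def mem_Collect_eq restrict_cells_def
  proof (intro conjI allI impI)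
    fix i j
    show "(if j < m i then T i j else 0) \<in> L" if "j < m i"
      using D(2)[OF less_le_trans[OF that ml]] that m by auto
    show "((if j < m i then T i j else 0) \<noteq> 0) = (j < m i)"
      using m[of j i] by auto
    show "(if Suc j < m i then T i (Suc j) else 0) \<le> (if j < m i then T i j else 0)"
      using D(3)[of j "Suc j" i] by auto
    show "(if j < m (Suc i) then T (Suc i) j else 0) \<le> (if j < m i then T i j else 0)"
      using D(4)[of i "Suc i" j] mS[of i] by auto
    show "(if Suc j < m i then T i (Suc j) else 0) \<noteq> (if j < m i then T i j else 0)"
      if "odd (if j < m i then T i j else 0)"
      using that D(5)[of i j] by (auto split: if_splits intro: odd_pos)
    show "(if j < m (Suc i) then T (Suc i) j else 0) \<noteq> (if j < m i then T i j else 0)"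
      if "j < m i" "even (if j < m i then T i j else 0)"
      using that D(6)[of j i] ml[of i] m[of j i] by (auto split: if_splits)
  qed
  show "extend t l m (restrict_cells m T) = T"
    using cell D(1) by (force simp: extend_def restrict_cells_def fun_eq_iff)
qed

text \<open>With \<open>restrict_tableau\<close> this is a bijection between the tableaux of shape
  \<open>l\<close> and the pairs of an inner shape and a tableau on it.\<close>

lemma extend_tableau:
  assumes t: "0 < t" "\<And>s. s \<in> L \<Longrightarrow> t < s" and l: "l \<in> partitions" and m: "m \<in> partitions"
    and s: "strip t m l" and T: "T \<in> tableaux L m"
  defines "U \<equiv> extend t l m T"
  shows "U \<in> tableaux (insert t L) l" "inner_shape t U = m" "restrict_cells m U = T"
proof -
  note D = tableauxD[OF T]
  have ml: "m i \<le> l i" for i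
    using s by (auto simp: strip_def hstrip_def vstrip_def split: if_splits)
  have lS: "l (Suc i) \<le> l i" and mS: "m (Suc i) \<le> m i" for i
    using partitions_antimono l m by simp_all
  have gt: "t < T i j" if "j < m i" for i j
    using D(2)[OF that] t(2) by blast
  have U: "U i j = (if j < m i then T i j else if j < l i then t else 0)" for i j
    by (simp add: U_def extend_def)
  have U_m: "t < U i j \<longleftrightarrow> j < m i" for i j
    using gt[of j i] by (simp add: U)
  show U_tab: "U \<in> tableaux (insert t L) l"
    unfolding tableaux_def mem_Collect_eq
  proof (intro conjI allI impI)
    fix i j
    show "(U i j \<noteq> 0) = (j < l i)"
      using t(1) gt[of j i] ml[of i] by (auto simp: U)
    show "U i j \<in> insert t L" if "j < l i"
      using that D(2)[of j i] by (auto simp: U)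
    show "U i (Suc j) \<le> U i j"
      using D(3)[of j "Suc j" i] gt[of j i] by (auto simp: U)
    show "U (Suc i) j \<le> U i j"
      using D(4)[of i "Suc i" j] gt[of j i] mS[of i] lS[of i] by (auto simp: U)
    show "U i (Suc j) \<noteq> U i j" if "odd (U i j)"
    proof
      assume eq: "U i (Suc j) = U i j"
      show False
      proof (cases "j < m i")
        case True
        then have "Suc j < m i"
          using U_m[of i j] U_m[of i "Suc j"] eq by simp
        then show False
          using True eq that D(5)[of i j] by (simp add: U)
      next
        case False
        then have "odd t" "Suc j < l i"
          using that eq by (auto simp: U split: if_splits)
        moreover from this have "l i \<le> Suc (m i)"
          using s by (simp add: strip_def vstrip_def)
        ultimately show False
          using False by simp
      qed
    qed
    show "U (Suc i) j \<noteq> U i j" if j: "j < l i" and "even (U i j)"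
    proof
      assume eq: "U (Suc i) j = U i j"
      show False
      proof (cases "j < m i")
        case True
        then have "j < m (Suc i)"
          using U_m[of i j] U_m[of "Suc i" j] eq by simp
        then show False
          using True eq that D(6)[of j i] by (simp add: U)
      next
        case False
        then have "even t" "j < l (Suc i)"
          using that eq t(1) mS[of i] by (auto simp: U split: if_splits)
        moreover from this have "l (Suc i) \<le> m i"
          using s by (simp add: strip_def hstrip_def)
        ultimately show False
          using False by simp
      qed
    qed
  qed
  show "inner_shape t U = m"
  proof
    fix i
    have "j < inner_shape t U i \<longleftrightarrow> j < m i" for j
      unfolding less_inner_shape_iff[OF U_tab] U_m ..
    then show "inner_shape t U i = m i"
      by (meson linorder_neqE_nat less_irrefl)
  qed
  show "restrict_cells m U = T"
    using D(1) by (force simp: restrict_cells_def U fun_eq_iff)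
qed

section \<open>Weights and generating functions of tableaux\<close>

definition tableau_weight :: "(nat \<Rightarrow> 'a::comm_ring_1) \<Rightarrow> (nat \<Rightarrow> nat \<Rightarrow> nat) \<Rightarrow> 'a" where
  "tableau_weight z T = (\<Prod>(i, j) | T i j \<noteq> 0. z (T i j))"

definition tableau_gf :: "(nat \<Rightarrow> 'a::comm_ring_1) \<Rightarrow> nat set \<Rightarrow> (nat \<Rightarrow> nat) \<Rightarrow> 'a" where
  "tableau_gf z L l = (\<Sum>T\<in>tableaux L l. tableau_weight z T)"

lemma tableau_support: "T \<in> tableaux L l \<Longrightarrow> {(i, j). T i j \<noteq> 0} = diagram l"
  using tableauxD(1) by (auto simp: diagram_def)

lemma tableau_weight_extend:
  assumes t: "0 < t" "\<And>s. s \<in> L \<Longrightarrow> t < s" and l: "l \<in> partitions" and m: "m \<in> partitions"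
    and s: "strip t m l" and T: "T \<in> tableaux L m"
  shows "tableau_weight z (extend t l m T) = z t ^ (psize l - psize m) * tableau_weight z T"
proof -
  let ?U = "extend t l m T"
  have sub: "diagram m \<subseteq> diagram l"
    using s by (auto simp: diagram_def strip_def hstrip_def vstrip_def split: if_splits
        intro: less_le_trans)
  have "{(i, j). ?U i j \<noteq> 0} = diagram l"
    by (rule tableau_support) (rule extend_tableau(1)[OF assms])
  then have "tableau_weight z ?U = (\<Prod>(i, j)\<in>diagram l. z (?U i j))"
    by (simp only: tableau_weight_def)
  also have "\<dots> = (\<Prod>(i, j)\<in>diagram l - diagram m. z (?U i j)) * (\<Prod>(i, j)\<in>diagram m. z (?U i j))"
    by (rule prod.subset_diff[OF sub finite_diagram[OF l]])
  also have "(\<Prod>(i, j)\<in>diagram l - diagram m. z (?U i j)) = (\<Prod>_\<in>diagram l - diagram m. z t)"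
    by (rule prod.cong) (auto simp: diagram_def extend_def)
  also have "\<dots> = z t ^ (psize l - psize m)"
    using sub l m by (simp add: card_Diff_subset finite_diagram card_diagram)
  also have "(\<Prod>(i, j)\<in>diagram m. z (?U i j)) = tableau_weight z T"
    unfolding tableau_weight_def tableau_support[OF T]
    by (rule prod.cong) (auto simp: diagram_def extend_def)
  finally show ?thesis .
qed

lemma graded_tableau_gf:
  fixes z :: "nat \<Rightarrow> 'a::comm_ring_1 fps"
  assumes z: "\<And>t. t \<in> L \<Longrightarrow> fps_X dvd z t"
  shows "graded (tableau_gf z L)"
  unfolding graded_def tableau_gf_def
proof (intro ballI dvd_sum)
  fix l T assume l: "l \<in> partitions" and T: "T \<in> tableaux L l"
  have "(\<Prod>_\<in>diagram l. fps_X) dvd (\<Prod>(i, j)\<in>diagram l. z (T i j))"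
    by (rule prod_dvd_prod) (use tableauxD(2)[OF T] z in \<open>auto simp: diagram_def\<close>)
  then show "fps_X ^ psize l dvd tableau_weight z T"
    unfolding tableau_weight_def tableau_support[OF T] by (simp add: card_diagram l)
qed

text \<open>The tableaux are sorted by the shape that the letters other than \<open>t\<close>
  occupy.\<close>

lemma tableau_gf_insert:
  fixes z :: "nat \<Rightarrow> 'a::comm_ring_1 fps"
  assumes L: "finite L" and t: "0 < t" "\<And>s. s \<in> L \<Longrightarrow> t < s"
    and z: "\<And>s. s \<in> insert t L \<Longrightarrow> fps_X dvd z s" and l: "l \<in> partitions"
  shows "tableau_gf z (insert t L) l = attach (strip t) (z t) (tableau_gf z L) l"
proof -
  let ?A = "{m \<in> partitions. strip t m l}"
  have "?A \<subseteq> {m \<in> partitions. psize m \<le> psize l}"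
    using hstrip_psize vstrip_psize l by (auto simp: strip_def split: if_splits)
  then have A: "finite ?A"
    by (rule finite_subset) (rule finite_partitions_le)
  have "attach (strip t) (z t) (tableau_gf z L) l =
      (\<Sum>m\<in>?A. if strip t m l then z t ^ (psize l - psize m) * tableau_gf z L m else 0)"
    unfolding attach_def
    by (rule psum_eq_sum[OF A]) (use z in \<open>auto intro!: graded_if graded_mult graded_tableau_gf\<close>)
  also have "\<dots> = (\<Sum>m\<in>?A. \<Sum>T\<in>tableaux L m. z t ^ (psize l - psize m) * tableau_weight z T)"
    by (rule sum.cong) (auto simp: tableau_gf_def sum_distrib_left)
  also have "\<dots> = (\<Sum>(m, T)\<in>(SIGMA m:?A. tableaux L m). z t ^ (psize l - psize m) * tableau_weight z T)"
    by (rule sum.Sigma[OF A]) (use finite_tableaux[OF L] in auto)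
  also have "\<dots> = (\<Sum>T\<in>tableaux (insert t L) l. tableau_weight z T)"
    by (rule sum.reindex_bij_witness[where
          i = "\<lambda>T. (inner_shape t T, restrict_cells (inner_shape t T) T)" and j = "\<lambda>(m, T). extend t l m T"])
       (use restrict_tableau[OF t l] extend_tableau[OF t l] tableau_weight_extend[OF t l] in auto)
  finally show ?thesis
    by (simp add: tableau_gf_def)
qed

subsection \<open>The formula for finite sets of parts\<close>

text \<open>\<open>Suc t div 2\<close> is the part behind both codes \<open>2 * k - 1\<close> and
  \<open>2 * k\<close>. The filler 0 would encode the part 0, so it is no letter when 0 is not in
  \<open>S\<close>.\<close>

definition letters :: "nat set \<Rightarrow> nat set" where
  "letters S = {t. Suc t div 2 \<in> S}"

definition letter_weight :: "'a::comm_ring_1 \<Rightarrow> nat \<Rightarrow> 'a fps" where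
  "letter_weight a t = fps_const (if odd t then a else 1) * fps_X ^ (Suc t div 2)"

abbreviation shape_gf :: "'a::comm_ring_1 \<Rightarrow> nat set \<Rightarrow> (nat \<Rightarrow> nat) \<Rightarrow> 'a fps" where
  "shape_gf a S \<equiv> tableau_gf (letter_weight a) (letters S)"

text \<open>The factor of the formula for a finite \<open>S\<close>, with \<open>inverse\<close> in
  place of division because it distributes over products.\<close>

definition finite_factor :: "nat set \<Rightarrow> 'a::field \<Rightarrow> nat \<Rightarrow> 'a fps" where
  "finite_factor S a i = (\<Prod>j\<in>S. 1 + fps_const a * fps_X ^ (i + j)) *
     inverse ((1 - fps_X ^ i) * (1 - fps_const a * fps_X ^ i)) *
     (\<Prod>j \<in> {j \<in> S. j < i}.
        inverse ((1 - fps_X ^ (i + j)) * (1 - fps_const (a ^ 2) * fps_X ^ (i + j))))"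

lemma letters_insert:
  assumes "0 < b"
  shows "letters (insert b S) = insert (2 * b - 1) (insert (2 * b) (letters S))"
  using assms by (auto simp: letters_def)

lemma finite_letters:
  assumes "finite S"
  shows "finite (letters S)"
proof (rule finite_subset)
  show "letters S \<subseteq> (\<Union>k\<in>S. {2 * k - 1, 2 * k})"
    by (force simp: letters_def)
qed (use assms in simp)

lemma fps_X_dvd_letter_weight:
  assumes "0 \<notin> S" "t \<in> letters S"
  shows "fps_X dvd letter_weight a t"
proof -
  have "Suc t div 2 \<noteq> 0"
    using assms by (metis letters_def mem_Collect_eq)
  then show ?thesis
    unfolding letter_weight_def by (intro dvd_mult dvd_power) simp
qed

text \<open>Letters enter in decreasing order: \<open>2 * b\<close> lies below all of
  \<open>letters S\<close>, and \<open>2 * b - 1\<close> below \<open>2 * b\<close>. So the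
  horizontal strip is attached before the vertical one.\<close>

lemma shape_gf_insert:
  fixes a :: "'a::comm_ring_1"
  assumes S: "finite S" and b: "0 < b" "\<And>s. s \<in> S \<Longrightarrow> b < s" and l: "l \<in> partitions"
  shows "shape_gf a (insert b S) l =
    attach vstrip (fps_const a * fps_X ^ b) (attach hstrip (fps_X ^ b) (shape_gf a S)) l"
proof -
  have S0: "0 \<notin> insert b S"
    using b by fastforce
  have gt: "2 * b < s" if "s \<in> letters S" for s
    using b(2)[of "Suc s div 2"] that by (simp add: letters_def)
  have w: "fps_X dvd letter_weight a s" if "s \<in> letters (insert b S)" for s
    using S0 that by (rule fps_X_dvd_letter_weight)
  let ?L = "letters S" and ?z = "letter_weight a"
  have "tableau_gf ?z (insert (2 * b) ?L) m = attach (strip (2 * b)) (?z (2 * b)) (tableau_gf ?z ?L) m"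
    if "m \<in> partitions" for m
    by (rule tableau_gf_insert) (use S b gt w that in \<open>auto simp: finite_letters letters_insert\<close>)
  then have *: "tableau_gf ?z (insert (2 * b) ?L) m = attach hstrip (fps_X ^ b) (tableau_gf ?z ?L) m"
    if "m \<in> partitions" for m
    using that by (simp add: strip_def letter_weight_def)
  have "2 * b - 1 < s" if "s \<in> insert (2 * b) ?L" for s
    using that gt[of s] b(1) by auto
  then have "tableau_gf ?z (insert (2 * b - 1) (insert (2 * b) ?L)) l =
      attach (strip (2 * b - 1)) (?z (2 * b - 1)) (tableau_gf ?z (insert (2 * b) ?L)) l"
    using S b w l by (intro tableau_gf_insert) (auto simp: finite_letters letters_insert)
  also have "\<dots> = attach vstrip (fps_const a * fps_X ^ b) (tableau_gf ?z (insert (2 * b) ?L)) l"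
    using b(1) by (simp add: strip_def letter_weight_def)
  also have "\<dots> = attach vstrip (fps_const a * fps_X ^ b) (attach hstrip (fps_X ^ b) (tableau_gf ?z ?L)) l"
    by (rule attach_cong) (rule *)
  finally show ?thesis
    using b(1) by (simp add: letters_insert)
qed

lemma shape_gf_empty: "shape_gf a {} l = (if l = (\<lambda>_. 0) then 1 else 0)"
proof -
  have "tableaux {} l = (if l = (\<lambda>_. 0) then {\<lambda>_ _. 0} else {})"
    by (auto simp: tableaux_def fun_eq_iff)
  then show ?thesis
    by (simp add: tableau_gf_def tableau_weight_def letters_def)
qed

text \<open>The new part \<open>b\<close> enters the factor of each \<open>i \<in> S\<close> in the
  numerator and as a further \<open>j < i\<close>, while its own factor has no \<open>j < b\<close>.
  Hence 1 + a q^(b+j) occurs twice for each \<open>j \<in> S\<close>.\<close>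

lemma prod_finite_factor_insert:
  fixes a :: "'a::field"
  assumes S: "finite S" and b: "\<And>s. s \<in> S \<Longrightarrow> b < s"
  shows "(\<Prod>i\<in>insert b S. finite_factor (insert b S) a i) =
    (1 + fps_const a * fps_X ^ (b + b)) * (\<Prod>j\<in>S. 1 + fps_const a * fps_X ^ (b + j)) *
    inverse ((1 - fps_X ^ b) * (1 - fps_const a * fps_X ^ b)) *
    (\<Prod>j\<in>S. (1 + fps_const a * fps_X ^ (b + j)) *
       inverse ((1 - fps_X ^ (b + j)) * (1 - fps_const (a ^ 2) * fps_X ^ (b + j)))) *
    (\<Prod>i\<in>S. finite_factor S a i)"
proof -
  have nb: "b \<notin> S"
    using b by blast
  have none: "{j \<in> insert b S. j < b} = {}"
    using b by fastforce
  have "finite_factor (insert b S) a i = (1 + fps_const a * fps_X ^ (b + i)) *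
      inverse ((1 - fps_X ^ (b + i)) * (1 - fps_const (a ^ 2) * fps_X ^ (b + i))) *
      finite_factor S a i" if i: "i \<in> S" for i
  proof -
    have "{j \<in> insert b S. j < i} = insert b {j \<in> S. j < i}"
      using b[OF i] by auto
    then show ?thesis
      using S nb by (simp add: finite_factor_def add.commute mult_ac)
  qed
  then have "(\<Prod>i\<in>S. finite_factor (insert b S) a i) =
      (\<Prod>j\<in>S. (1 + fps_const a * fps_X ^ (b + j)) *
         inverse ((1 - fps_X ^ (b + j)) * (1 - fps_const (a ^ 2) * fps_X ^ (b + j)))) *
      (\<Prod>i\<in>S. finite_factor S a i)"
    by (simp add: prod.distrib)
  moreover have "finite_factor (insert b S) a b =
      (1 + fps_const a * fps_X ^ (b + b)) * (\<Prod>j\<in>S. 1 + fps_const a * fps_X ^ (b + j)) *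
      inverse ((1 - fps_X ^ b) * (1 - fps_const a * fps_X ^ b))"
    unfolding finite_factor_def none by (simp only: prod.insert[OF S nb] prod.empty mult_1_right)
  ultimately show ?thesis
    by (simp only: prod.insert[OF S nb] mult.assoc)
qed

text \<open>The eigenvalue is carried through the induction because it determines how the sum
  changes. Each new part lies below the previous ones, which is the order in which strips are
  attached.\<close>

lemma shape_gf_psum:
  fixes a :: "'a::field"
  assumes "finite S" "0 \<notin> S"
  shows "eigenvector (shape_gf a S)
           (\<lambda>x. \<Prod>j\<in>S. (1 + x * (fps_const a * fps_X ^ j)) * inverse (1 - x * fps_X ^ j)) \<and>
         psum (shape_gf a S) = (\<Prod>i\<in>S. finite_factor S a i)"
  using assms
proof (induction S rule: finite_linorder_min_induct)
  case empty
  let ?v = "\<lambda>l :: nat \<Rightarrow> nat. if l = (\<lambda>_. 0) then 1 else 0 :: 'a fps"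
  have "psum ?v = sum ?v {\<lambda>_. 0}"
    by (rule psum_eq_sum) (auto simp: zero_partition graded_def)
  then show ?case
    using eigenvector_vacuum[where 'a = 'a] by (simp add: shape_gf_empty[abs_def])
next
  case (insert b S)
  have b: "0 < b" "\<And>s. s \<in> S \<Longrightarrow> b < s" and nb: "b \<notin> S"
    using insert by auto
  define w where "w = shape_gf a S"
  define x :: "'a fps" where "x = fps_X ^ b"
  define y :: "'a fps" where "y = fps_const a * fps_X ^ b"
  define c :: "'a fps \<Rightarrow> 'a fps" where
    "c t = (\<Prod>j\<in>S. (1 + t * (fps_const a * fps_X ^ j)) * inverse (1 - t * fps_X ^ j))" for t
  have x: "fps_X dvd x" and y: "fps_X dvd y"
    using b(1) by (simp_all add: x_def y_def dvd_mult dvd_power)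
  have w: "eigenvector w c" and psum_w: "psum w = (\<Prod>i\<in>S. finite_factor S a i)"
    using insert by (auto simp: w_def c_def[abs_def])
  define w1 where "w1 = attach hstrip x w"
  define w2 where "w2 = attach vstrip y w1"
  have w1: "eigenvector w1 (\<lambda>t. c t * inverse (1 - t * x))"
    unfolding w1_def using w x by (rule eigenvector_attach_hstrip)
  have w2: "eigenvector w2 (\<lambda>t. c t * inverse (1 - t * x) * (1 + t * y))"
    unfolding w2_def using w1 y by (rule eigenvector_attach_vstrip)
  have gf: "shape_gf a (insert b S) l = w2 l" if "l \<in> partitions" for l
    unfolding w2_def w1_def w_def x_def y_def
    by (rule shape_gf_insert) (use insert.hyps b that in auto)
  define E :: "'a fps" where "E = (\<Prod>j\<in>S. 1 + fps_const a * fps_X ^ (b + j))"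
  define H :: "'a fps" where "H = (\<Prod>j\<in>S. inverse (1 - fps_X ^ (b + j)))"
  define E' :: "'a fps" where "E' = (\<Prod>j\<in>S. inverse (1 + fps_const a * fps_X ^ (b + j)))"
  define A :: "'a fps" where "A = (\<Prod>j\<in>S. 1 - fps_const (a ^ 2) * fps_X ^ (b + j))"
  define A' :: "'a fps" where "A' = (\<Prod>j\<in>S. inverse (1 - fps_const (a ^ 2) * fps_X ^ (b + j)))"
  have cx: "c x = E * H"
    by (simp add: c_def E_def H_def x_def prod.distrib power_add mult_ac)
  \<comment> \<open>The sum is divided by this value: \<open>A\<close> goes to the denominator, and
    \<open>E'\<close> supplies the second copy of \<open>E\<close>.\<close>
  have cy: "c (- y) = A * E'"
    by (simp add: c_def E'_def A_def y_def prod.distrib power_add power2_eq_square mult_ac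
        flip: fps_const_mult)
  have unit: "inverse (1 - fps_const u * fps_X ^ (b + j)) * (1 - fps_const u * fps_X ^ (b + j)) = 1"
    for u :: 'a and j
    by (rule one_minus_unit) (use b(1) in \<open>auto intro: dvd_mult dvd_power\<close>)
  have AA: "A' * A = 1"
    by (simp add: A_def A'_def unit flip: prod.distrib)
  have EE: "E' * E = 1"
    unfolding E_def E'_def using unit[of "- a"] by (simp flip: prod.distrib fps_const_neg)
  have yy: "inverse (1 - y) * (1 - y) = 1"
    by (rule one_minus_unit[OF y])
  have xy: "inverse (1 + x * y) * (1 + x * y) = 1"
    using one_minus_unit[of "- (x * y)"] x by simp
  \<comment> \<open>\<open>w1\<close> already includes the horizontal strips for \<open>b\<close>
    itself; its extra eigenvalue factor at \<open>- y\<close> is the origin of 1 + a q^(2b).\<close>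
  have "(1 - y) * (c (- y) * inverse (1 - - y * x)) * psum w2 = psum w1"
    unfolding w2_def using psum_attach_vstrip_eigenvector[OF w1 y] .
  also have "\<dots> = inverse (1 - x) * c x * psum w"
    unfolding w1_def using w x by (rule psum_attach_hstrip_eigenvector)
  finally have main: "(1 - y) * (A * E' * inverse (1 + x * y)) * psum w2 = inverse (1 - x) * (E * H) * psum w"
    by (simp add: cx cy mult.commute[of y x])
  \<comment> \<open>Products equal to 1 are inserted so that the left side of \<open>main\<close>
    can be split off.\<close>
  have "psum w2 = (inverse (1 - y) * (1 - y)) * (A' * A) * (E' * E) *
      (inverse (1 + x * y) * (1 + x * y)) * psum w2"
    by (simp only: AA EE yy xy mult_1_left)
  also have "\<dots> = inverse (1 - y) * A' * E * (1 + x * y) *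
      ((1 - y) * (A * E' * inverse (1 + x * y)) * psum w2)"
    by (simp only: mult_ac)
  also have "\<dots> = (1 + x * y) * E * (inverse (1 - x) * inverse (1 - y)) * (E * (H * A')) * psum w"
    unfolding main by (simp only: mult_ac)
  also have "\<dots> = (\<Prod>i\<in>insert b S. finite_factor (insert b S) a i)"
    by (subst prod_finite_factor_insert[OF insert.hyps(1) b(2)])
      (simp_all add: psum_w E_def H_def A'_def x_def y_def prod.distrib fps_inverse_mult power_add mult_ac)
  finally have "psum (shape_gf a (insert b S)) = (\<Prod>i\<in>insert b S. finite_factor (insert b S) a i)"
    using psum_cong[of "shape_gf a (insert b S)" w2] gf by simp
  moreover have "eigenvector (shape_gf a (insert b S)) (\<lambda>t. \<Prod>j\<in>insert b S.
      (1 + t * (fps_const a * fps_X ^ j)) * inverse (1 - t * fps_X ^ j))"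
    using eigenvector_cong[OF w2 gf] insert.hyps(1) nb by (simp add: c_def x_def y_def mult_ac)
  ultimately show ?case
    by blast
qed

subsection \<open>Plane overpartitions as tableaux\<close>

definition encode :: "nat \<times> bool \<Rightarrow> nat" where
  "encode = (\<lambda>(k, b). if b then 2 * k - 1 else 2 * k)"

definition decode :: "nat \<Rightarrow> nat \<times> bool" where
  "decode t = (Suc t div 2, odd t)"

definition row_lengths :: "filling \<Rightarrow> nat \<Rightarrow> nat" where
  "row_lengths P i = (if i < length P then length (P ! i) else 0)"

definition tableau_of :: "filling \<Rightarrow> nat \<Rightarrow> nat \<Rightarrow> nat" where
  "tableau_of P i j = (if j < row_lengths P i then encode (P ! i ! j) else 0)"

definition num_rows :: "(nat \<Rightarrow> nat) \<Rightarrow> nat" where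
  "num_rows l = (LEAST i. l i = 0)"

definition filling_of :: "(nat \<Rightarrow> nat) \<Rightarrow> (nat \<Rightarrow> nat \<Rightarrow> nat) \<Rightarrow> filling" where
  "filling_of l T = map (\<lambda>i. map (\<lambda>j. decode (T i j)) [0..<l i]) [0..<num_rows l]"

lemma encode_decode: "encode (decode t) = t"
  by (cases "even t") (auto simp: encode_def decode_def elim!: evenE oddE)

text \<open>For the part 0 the code \<open>2 * k - 1\<close> truncates to 0 and the flag is
  lost.\<close>

lemma decode_encode:
  assumes "0 < fst c"
  shows "decode (encode c) = c"
proof (cases c)
  case (Pair k b)
  with assms obtain k' where "k = Suc k'"
    by (cases k) auto
  with Pair show ?thesis
    by (simp add: encode_def decode_def)
qed

lemma less_num_rows_iff:
  assumes "l \<in> partitions"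
  shows "i < num_rows l \<longleftrightarrow> l i \<noteq> 0"
proof
  show "l i \<noteq> 0" if "i < num_rows l"
    using not_less_Least[OF that[unfolded num_rows_def]] .
  obtain N where "l N = 0"
    using partitions_bounded[OF assms] by blast
  then have "l (num_rows l) = 0"
    unfolding num_rows_def by (rule LeastI)
  then show "i < num_rows l" if "l i \<noteq> 0"
    using that partitions_antimono[OF assms, of "num_rows l" i] by (cases "i < num_rows l") auto
qed

lemma cells_eq_diagram: "cells P = diagram (row_lengths P)"
  by (auto simp: cells_def diagram_def shape_def row_lengths_def split: if_splits)

text \<open>A partition has no part 0, so no row is empty and the number of rows can be read off
  from the row lengths.\<close>

lemma row_lengths_partition:
  assumes "is_partition (shape P)"
  shows "row_lengths P \<in> partitions" "i < length P \<longleftrightarrow> row_lengths P i \<noteq> 0"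
proof -
  have "length (P ! i) \<ge> length (P ! Suc i)" if "Suc i < length P" for i
    using assms that by (auto simp: is_partition_def shape_def sorted_wrt_iff_nth_less)
  then show "row_lengths P \<in> partitions"
    by (intro partitionsI[where N = "length P"]) (auto simp: row_lengths_def)
  have "length (P ! i) \<noteq> 0" if "i < length P"
    using assms that by (metis is_partition_def length_map nth_map nth_mem shape_def)
  then show "i < length P \<longleftrightarrow> row_lengths P i \<noteq> 0"
    by (auto simp: row_lengths_def)
qed

lemma filling_of_tableau_of:
  assumes P: "is_partition (shape P)" and "\<And>i j. j < row_lengths P i \<Longrightarrow> 0 < entry P i j"
  shows "filling_of (row_lengths P) (tableau_of P) = P"
proof (rule nth_equalityI)
  note R = row_lengths_partition[OF P]
  have "i < num_rows (row_lengths P) \<longleftrightarrow> i < length P" for i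
    by (simp add: less_num_rows_iff R)
  then have "num_rows (row_lengths P) = length P"
    by (meson linorder_neqE_nat less_irrefl)
  then show len: "length (filling_of (row_lengths P) (tableau_of P)) = length P"
    by (simp add: filling_of_def)
  fix i assume "i < length (filling_of (row_lengths P) (tableau_of P))"
  then have i: "i < length P" "i < num_rows (row_lengths P)"
    using len by (simp_all add: filling_of_def)
  show "filling_of (row_lengths P) (tableau_of P) ! i = P ! i"
    by (rule nth_equalityI)
       (use i assms(2)[of _ i] in \<open>auto simp: filling_of_def row_lengths_def tableau_of_def decode_encode entry_def\<close>)
qed

lemma tableau_of_filling:
  assumes P: "P \<in> plane_overpartitions_in S"
  shows "row_lengths P \<in> partitions" "tableau_of P \<in> tableaux (letters S) (row_lengths P)"
    "filling_of (row_lengths P) (tableau_of P) = P"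
proof -
  let ?l = "row_lengths P" and ?T = "tableau_of P"
  have part: "is_partition (shape P)"
    using P by (simp add: plane_overpartitions_in_def plane_overpartition_def)
  show l: "?l \<in> partitions"
    by (rule row_lengths_partition[OF part])
  have c: "(i, j) \<in> cells P \<longleftrightarrow> j < ?l i" for i j
    by (simp add: cells_eq_diagram diagram_def)
  have pos: "0 < entry P i j" and S: "entry P i j \<in> S" if "j < ?l i" for i j
    using P that by (auto simp: plane_overpartitions_in_def plane_overpartition_def simp flip: c)
  have row: "entry P i (Suc j) \<le> entry P i j"
      "entry P i (Suc j) = entry P i j \<Longrightarrow> \<not> overlined P i j" if "Suc j < ?l i" for i j
    using P that Suc_lessD[OF that] lessI[of j]
    unfolding plane_overpartitions_in_def plane_overpartition_def mem_Collect_eq c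
    by blast+
  have lS: "?l (Suc i) \<le> ?l i" for i
    using partitions_antimono[OF l] by simp
  have col: "entry P (Suc i) j \<le> entry P i j"
      "entry P (Suc i) j = entry P i j \<Longrightarrow> overlined P (Suc i) j" if "j < ?l (Suc i)" for i j
    using P that less_le_trans[OF that lS] lessI[of i]
    unfolding plane_overpartitions_in_def plane_overpartition_def mem_Collect_eq c
    by blast+
  have T: "?T i j = (if j < ?l i then if overlined P i j then 2 * entry P i j - 1 else 2 * entry P i j else 0)"
    for i j
    by (simp add: tableau_of_def encode_def entry_def overlined_def split_beta)
  have e: "entry P i j = Suc (?T i j) div 2" "overlined P i j \<longleftrightarrow> odd (?T i j)" if "j < ?l i" for i j
    using that pos[OF that] by (auto simp: T)
  show "?T \<in> tableaux (letters S) ?l"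
    unfolding tableaux_def mem_Collect_eq
  proof (intro conjI allI impI)
    fix i j
    show "?T i j \<noteq> 0 \<longleftrightarrow> j < ?l i"
      using pos[of j i] by (auto simp: T)
    show "?T i j \<in> letters S" if "j < ?l i"
      using that pos[of j i] S[of j i] by (auto simp: T letters_def)
    \<comment> \<open>Different parts have codes in the same order whatever the flags. For equal
      parts the left one is not overlined and has the larger code; in columns, the lower one is
      overlined and has the smaller code.\<close>
    show "?T i (Suc j) \<le> ?T i j"
      using row[of j i] by (cases "entry P i (Suc j) = entry P i j") (auto simp: T)
    show "?T (Suc i) j \<le> ?T i j"
      using col[of j i] lS[of i] by (cases "entry P (Suc i) j = entry P i j") (auto simp: T)
    show "?T i (Suc j) \<noteq> ?T i j" if "odd (?T i j)"
    proof
      assume eq: "?T i (Suc j) = ?T i j"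
      with that have j: "Suc j < ?l i" "j < ?l i"
        by (auto simp: T split: if_splits)
      then have "entry P i (Suc j) = entry P i j" "overlined P i j"
        using eq that by (simp_all add: e)
      then show False
        using row(2)[OF j(1)] by blast
    qed
    show "?T (Suc i) j \<noteq> ?T i j" if "j < ?l i" "even (?T i j)"
    proof
      assume eq: "?T (Suc i) j = ?T i j"
      with that pos[of j i] have j: "j < ?l (Suc i)"
        by (auto simp: T split: if_splits)
      then have "entry P (Suc i) j = entry P i j" "\<not> overlined P (Suc i) j"
        using eq that by (simp_all add: e)
      then show False
        using col(2)[OF j] by blast
    qed
  qed
  show "filling_of ?l ?T = P"
    using part pos by (rule filling_of_tableau_of)
qed

lemma filling_of_tableau:
  assumes S: "0 \<notin> S" and l: "l \<in> partitions" and T: "T \<in> tableaux (letters S) l"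
  shows "filling_of l T \<in> plane_overpartitions_in S" "row_lengths (filling_of l T) = l"
    "tableau_of (filling_of l T) = T"
proof -
  let ?P = "filling_of l T"
  note D = tableauxD[OF T]
  have len: "length ?P = num_rows l"
    by (simp add: filling_of_def)
  have row: "?P ! i = map (\<lambda>j. decode (T i j)) [0..<l i]" if "i < num_rows l" for i
    using that by (simp add: filling_of_def)
  show rl: "row_lengths ?P = l"
    using less_num_rows_iff[OF l] by (auto simp: row_lengths_def len row fun_eq_iff)
  have nth: "?P ! i ! j = decode (T i j)" if "j < l i" for i j
    using that less_num_rows_iff[OF l, of i] by (simp add: row)
  show "tableau_of ?P = T"
    using D(1) by (force simp: tableau_of_def rl nth encode_decode fun_eq_iff)
  have c: "(i, j) \<in> cells ?P \<longleftrightarrow> j < l i" for i j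
    by (simp add: cells_eq_diagram diagram_def rl)
  have e: "entry ?P i j = Suc (T i j) div 2" "overlined ?P i j \<longleftrightarrow> odd (T i j)" if "j < l i" for i j
    using that by (simp_all add: entry_def overlined_def nth decode_def)
  \<comment> \<open>The only unequal codes \<open>s \<le> t\<close> of the same part are
    \<open>2 * k - 1\<close> and \<open>2 * k\<close>, which the parity condition excludes.\<close>
  have eq: "s = t" if "Suc s div 2 = Suc t div 2" "s \<le> t" "odd t \<or> even s" for s t :: nat
    using that by presburger
  have sh: "shape ?P = map l [0..<num_rows l]"
    by (simp add: shape_def filling_of_def)
  have "sorted_wrt (\<ge>) (shape ?P)"
    unfolding sh sorted_wrt_iff_nth_less using partitions_antimono[OF l] by simp
  moreover have "0 \<notin> set (shape ?P)"
  proof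
    assume "0 \<in> set (shape ?P)"
    then obtain i where "i < num_rows l" "l i = 0"
      by (auto simp: sh)
    then show False
      using less_num_rows_iff[OF l, of i] by simp
  qed
  ultimately have "is_partition (shape ?P)"
    by (simp add: is_partition_def)
  moreover have "entry ?P i j \<in> S" if "j < l i" for i j
    using D(2)[OF that] that by (simp add: e letters_def)
  moreover have "0 < entry ?P i j" if "j < l i" for i j
    using D(1)[of i j] that by (cases "T i j") (simp_all add: e)
  moreover have "entry ?P i j' \<le> entry ?P i j" if "j < l i" "j' < l i" "j < j'" for i j j'
    using that D(3)[of j j' i] by (simp add: e div_le_mono)
  moreover have "entry ?P i' j \<le> entry ?P i j" if "j < l i" "j < l i'" "i < i'" for i i' j
    using that D(4)[of i i' j] by (simp add: e div_le_mono)
  moreover have "\<not> overlined ?P i j"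
    if "j < l i" "j' < l i" "j < j'" "entry ?P i j' = entry ?P i j" for i j j'
  proof
    assume o: "overlined ?P i j"
    then have "T i j' = T i j"
      using that D(3)[of j j' i] by - (rule eq, simp_all add: e)
    \<comment> \<open>The row is constant from \<open>j\<close> to \<open>j'\<close>, so the
      forbidden repetition already occurs at the neighbour.\<close>
    then have "T i (Suc j) = T i j"
      using that D(3)[of j "Suc j" i] D(3)[of "Suc j" j' i] by simp
    then show False
      using D(5)[of i j] o that by (simp add: e)
  qed
  moreover have "overlined ?P i' j"
    if "j < l i" "j < l i'" "i < i'" "entry ?P i' j = entry ?P i j" for i i' j
  proof (rule ccontr)
    assume o: "\<not> overlined ?P i' j"
    then have Teq: "T i' j = T i j"
      using that D(4)[of i i' j] by - (rule eq, simp_all add: e)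
    then have "T (Suc i) j = T i j"
      using that D(4)[of i "Suc i" j] D(4)[of "Suc i" i' j] by simp
    then show False
      using D(6)[of j i] o that Teq by (simp add: e)
  qed
  ultimately show "?P \<in> plane_overpartitions_in S"
    unfolding plane_overpartitions_in_def plane_overpartition_def by (auto simp: c)
qed

lemma finite_cells:
  assumes "P \<in> plane_overpartitions_in S"
  shows "finite (cells P)"
  using tableau_of_filling(1)[OF assms] by (simp add: cells_eq_diagram finite_diagram)

lemma fps_const_prod_power: "(\<Prod>x\<in>A. if Q x then fps_const a else 1) = fps_const (a ^ card {x \<in> A. Q x})"
  if "finite A" for a :: "'a::comm_ring_1"
  using that by (simp flip: prod.inter_filter)

lemma filling_weight:
  fixes a :: "'a::comm_ring_1"
  assumes P: "P \<in> plane_overpartitions_in S"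
  shows "fps_const (a ^ num_overlined P) * fps_X ^ weight P =
    tableau_weight (letter_weight a) (tableau_of P)"
proof -
  have pos: "0 < entry P i j" if "(i, j) \<in> cells P" for i j
    using P that by (auto simp: plane_overpartitions_in_def plane_overpartition_def)
  have "tableau_weight (letter_weight a) (tableau_of P) =
      (\<Prod>(i, j)\<in>cells P. letter_weight a (tableau_of P i j))"
    unfolding tableau_weight_def tableau_support[OF tableau_of_filling(2)[OF P]]
    by (simp add: cells_eq_diagram)
  also have "\<dots> = (\<Prod>(i, j)\<in>cells P. (if overlined P i j then fps_const a else 1) * fps_X ^ entry P i j)"
  proof (rule prod.cong[OF refl], clarify)
    fix i j assume ij: "(i, j) \<in> cells P"
    then have "tableau_of P i j = (if overlined P i j then 2 * entry P i j - 1 else 2 * entry P i j)"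
      by (simp add: cells_eq_diagram diagram_def tableau_of_def encode_def entry_def overlined_def split_beta)
    then show "letter_weight a (tableau_of P i j) =
        (if overlined P i j then fps_const a else 1) * fps_X ^ entry P i j"
      using pos[OF ij] by (auto simp: letter_weight_def)
  qed
  also have "\<dots> = (\<Prod>x\<in>cells P. if case x of (i, j) \<Rightarrow> overlined P i j then fps_const a else 1) *
      fps_X ^ weight P"
    by (simp add: prod.distrib split_beta weight_def power_sum)
  also have "\<dots> = fps_const (a ^ num_overlined P) * fps_X ^ weight P"
    unfolding fps_const_prod_power[OF finite_cells[OF P]] num_overlined_def
    by (rule arg_cong[where f = "\<lambda>A. fps_const (a ^ card A) * _"]) auto
  finally show ?thesis ..
qed

subsection \<open>Infinite products\<close>

text \<open>Congruence modulo q^n.\<close>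

definition agree :: "nat \<Rightarrow> 'a::comm_ring_1 fps \<Rightarrow> 'a fps \<Rightarrow> bool" where
  "agree n f g \<longleftrightarrow> (\<forall>k<n. f $ k = g $ k)"

lemma agree_refl: "agree n f f"
  by (simp add: agree_def)

lemma agree_trans: "agree n f g \<Longrightarrow> agree n g h \<Longrightarrow> agree n f h"
  by (simp add: agree_def)

lemma agree_mult: "agree n f f' \<Longrightarrow> agree n g g' \<Longrightarrow> agree n (f * g) (f' * g')"
  by (auto simp: agree_def fps_mult_nth intro!: sum.cong)

lemma agree_prod: "(\<And>i. i \<in> A \<Longrightarrow> agree n (f i) (g i)) \<Longrightarrow> agree n (prod f A) (prod g A)"
  by (induction A rule: infinite_finite_induct) (auto intro: agree_mult agree_refl)

lemma agree_1_add: "agree n (1 + c * fps_X ^ k) 1" "agree n (1 - c * fps_X ^ k) 1" if "n \<le> k"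
  using that by (auto simp: agree_def fps_X_power_mult_right_nth)

lemma agree_inverse_1:
  fixes f :: "'a::field fps"
  assumes "agree n f 1"
  shows "agree n (inverse f) 1"
proof (cases "n = 0")
  case False
  then have "f $ 0 = 1"
    using assms by (simp add: agree_def)
  then have "inverse f * f = 1"
    by (intro inverse_mult_eq_1) simp
  then have "agree n 1 (inverse f)"
    using agree_mult[OF agree_refl assms, of "inverse f"] by simp
  then show ?thesis
    by (simp add: agree_def)
qed (simp add: agree_def)

text \<open>Factor \<open>i\<close> leaves the coefficients below \<open>i\<close> alone, so
  coefficient \<open>n\<close> is settled by the factors up to \<open>n\<close>. The
  \<open>max 1\<close> concerns \<open>i = 0\<close>: its constant term must be 1 as well, for a
  convergent product needs a nonzero limit.\<close>

lemma fps_prodinf: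
  fixes f :: "nat \<Rightarrow> 'a::field fps"
  assumes "\<And>i. agree (max 1 i) (f i) 1"
  shows "convergent_prod f" "agree (Suc n) (prodinf f) (\<Prod>i\<le>n. f i)"
proof -
  define p where "p = Abs_fps (\<lambda>n. (\<Prod>i\<le>n. f i) $ n)"
  have p: "(\<Prod>i\<le>m. f i) $ n = p $ n" if "n \<le> m" for n m
    using that
  proof (induction m rule: dec_induct)
    case base
    then show ?case
      by (simp add: p_def)
  next
    case (step m)
    have "agree (Suc m) ((\<Prod>i\<le>m. f i) * f (Suc m)) ((\<Prod>i\<le>m. f i) * 1)"
      using assms[of "Suc m"] by (intro agree_mult agree_refl) simp
    then show ?case
      using step by (simp add: agree_def)
  qed
  have "(\<lambda>n. \<Prod>i\<le>n. f i) \<longlonglongrightarrow> p"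
    by (rule tendsto_fpsI) (use p eventually_ge_at_top in \<open>auto simp: eventually_at_top_linorder\<close>)
  moreover have "p $ 0 = 1"
    using assms[of 0] by (simp add: p_def agree_def)
  then have "p \<noteq> 0"
    by auto
  ultimately have *: "raw_has_prod f 0 p"
    by (simp add: raw_has_prod_def)
  then show "convergent_prod f"
    by (auto simp: convergent_prod_def)
  have "f has_prod p"
    using * by (simp add: has_prod_def)
  then have "prodinf f = p"
    using has_prod_unique by metis
  then show "agree (Suc n) (prodinf f) (\<Prod>i\<le>n. f i)"
    using p by (simp add: agree_def)
qed

section \<open>Truncating the product to parts up to n\<close>

lemma
  fixes a :: "'a::field"
  assumes S: "0 \<notin> S" and i: "i \<in> S"
  shows convergent_numerator_factor: "convergent_prod (numerator_factor S a i)"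
    and prodinf_numerator_factor: "agree (Suc n) (\<Prod>j. numerator_factor S a i j)
          (\<Prod>j\<in>{j \<in> S. j \<le> n}. 1 + fps_const a * fps_X ^ (i + j))"
proof -
  have *: "agree (max 1 j) (numerator_factor S a i j) 1" for j
    unfolding numerator_factor_def using S i by (auto intro!: agree_1_add agree_refl simp: Suc_le_eq intro: gr0I)
  then show "convergent_prod (numerator_factor S a i)"
    by (rule fps_prodinf)
  have "(\<Prod>j\<le>n. numerator_factor S a i j) = (\<Prod>j\<in>{j \<in> S. j \<le> n}. 1 + fps_const a * fps_X ^ (i + j))"
    unfolding numerator_factor_def
    by (rule prod.mono_neutral_cong_right) auto
  then show "agree (Suc n) (\<Prod>j. numerator_factor S a i j)
          (\<Prod>j\<in>{j \<in> S. j \<le> n}. 1 + fps_const a * fps_X ^ (i + j))"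
    using fps_prodinf(2)[OF *] by metis
qed

text \<open>Truncation affects only the infinite product in the numerator, since the denominators
  involve no \<open>j\<close> beyond \<open>i \<le> n\<close>.\<close>

lemma product_factor_agree:
  fixes a :: "'a::field"
  assumes S: "0 \<notin> S" and i: "i \<in> S" "i \<le> n"
  shows "agree (Suc n) (product_factor S a i) (finite_factor {j \<in> S. j \<le> n} a i)"
proof -
  have i0: "i \<noteq> 0"
    using S i by metis
  have unit: "(1 / ((1 - fps_X ^ k) * (1 - fps_const u * fps_X ^ k))) =
      inverse ((1 - fps_X ^ k) * (1 - fps_const u * fps_X ^ k))"
    "f / ((1 - fps_X ^ k) * (1 - fps_const u * fps_X ^ k)) =
      f * inverse ((1 - fps_X ^ k) * (1 - fps_const u * fps_X ^ k))"
    if "k \<noteq> 0" for k and u :: 'a and f :: "'a fps"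
    by (subst fps_divide_unit, use that in simp_all)+
  have sub: "{j \<in> {j \<in> S. j \<le> n}. j < i} = {j \<in> S. j < i}"
    using i by auto
  have "product_factor S a i = (\<Prod>j. numerator_factor S a i j) *
      inverse ((1 - fps_X ^ i) * (1 - fps_const a * fps_X ^ i)) *
      (\<Prod>j \<in> {j \<in> S. j < i}.
        inverse ((1 - fps_X ^ (i + j)) * (1 - fps_const (a ^ 2) * fps_X ^ (i + j))))"
    using i i0 unit(1)[of "i + _" "a ^ 2"] unit(2)[OF i0, of _ a] by (simp add: product_factor_def)
  then show ?thesis
    unfolding finite_factor_def sub
    by (auto intro!: agree_mult agree_refl prodinf_numerator_factor S i)
qed

text \<open>All exponents of q in the factor of \<open>i\<close> are at least
  \<open>i\<close>.\<close>

lemma product_factor_agree_1: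
  fixes a :: "'a::field"
  assumes S: "0 \<notin> S"
  shows "agree (max 1 i) (product_factor S a i) 1"
proof (cases "i \<in> S")
  case True
  then obtain n where n: "i = Suc n"
    using S by (cases i) auto
  have 1: "agree i f 1 \<Longrightarrow> agree i g 1 \<Longrightarrow> agree i (f * g) 1" for f g :: "'a fps"
    using agree_mult[of i f 1 g 1] by simp
  have 2: "(\<And>j. j \<in> A \<Longrightarrow> agree i (f j) 1) \<Longrightarrow> agree i (prod f A) 1" for A and f :: "nat \<Rightarrow> 'a fps"
    using agree_prod[of A i f "\<lambda>_. 1"] by simp
  have "agree i (1 - fps_const u * fps_X ^ k) 1" "agree i (1 - fps_X ^ k) 1" if "i \<le> k"
    for k and u :: 'a
    using agree_1_add(2)[OF that, of "fps_const u"] agree_1_add(2)[OF that, of 1] by simp_all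
  then have "agree i (finite_factor {j \<in> S. j \<le> i} a i) 1"
    unfolding finite_factor_def by (intro 1 2 agree_inverse_1 agree_1_add) auto
  moreover have "agree i (product_factor S a i) (finite_factor {j \<in> S. j \<le> i} a i)"
    using product_factor_agree[OF S True order_refl, of a] unfolding agree_def
    by (meson less_SucI)
  ultimately show ?thesis
    using n agree_trans by simp
qed (simp add: product_factor_def agree_refl)

lemma prodinf_product_factor:
  fixes a :: "'a::field"
  assumes S: "0 \<notin> S"
  shows "agree (Suc n) (\<Prod>i. product_factor S a i)
    (\<Prod>i\<in>{i \<in> S. i \<le> n}. finite_factor {i \<in> S. i \<le> n} a i)"
proof -
  have "(\<Prod>i\<le>n. product_factor S a i) = (\<Prod>i\<in>{i \<in> S. i \<le> n}. product_factor S a i)"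
    by (rule prod.mono_neutral_right) (auto simp: product_factor_def)
  moreover have "agree (Suc n) \<dots> (\<Prod>i\<in>{i \<in> S. i \<le> n}. finite_factor {i \<in> S. i \<le> n} a i)"
    by (rule agree_prod, rule product_factor_agree[OF S]) auto
  moreover have "agree (Suc n) (\<Prod>i. product_factor S a i) (\<Prod>i\<le>n. product_factor S a i)"
    using product_factor_agree_1[OF S] by (rule fps_prodinf)
  ultimately show ?thesis
    by (simp add: agree_def)
qed

text \<open>Each coefficient of the finite partial sums is constant as soon as the index set
  contains \<open>X n\<close>.\<close>

lemma fps_has_sumI:
  fixes f :: "'b \<Rightarrow> 'a::comm_ring_1 fps"
  assumes "\<And>n. finite (X n) \<and> X n \<subseteq> A \<and> (\<forall>x\<in>A - X n. f x $ n = 0) \<and> (\<Sum>x\<in>X n. f x $ n) = s $ n"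
  shows "(f has_sum s) A"
  unfolding has_sum_def
proof (rule tendsto_fpsI)
  fix n
  have "sum f Y $ n = s $ n" if "finite Y" "X n \<subseteq> Y" "Y \<subseteq> A" for Y
  proof -
    have "(\<Sum>x\<in>Y. f x $ n) = (\<Sum>x\<in>X n. f x $ n)"
      by (rule sum.mono_neutral_right) (use that assms in auto)
    then show ?thesis
      using assms by (simp add: fps_sum_nth)
  qed
  then show "\<forall>\<^sub>F Y in finite_subsets_at_top A. sum f Y $ n = s $ n"
    using assms unfolding eventually_finite_subsets_at_top by meson
qed

theorem theorem13:
  fixes S :: "nat set" and a :: "'a::field"
  assumes "0 \<notin> S"
  shows "(\<forall>i\<in>S. convergent_prod (numerator_factor S a i)) \<and>
         convergent_prod (product_factor S a) \<and>
         ((\<lambda>P. fps_const (a ^ num_overlined P) * fps_X ^ weight P) has_sum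
            (\<Prod>i. product_factor S a i)) (plane_overpartitions_in S)"
proof (intro conjI ballI)
  show "convergent_prod (numerator_factor S a i)" if "i \<in> S" for i
    using assms that by (rule convergent_numerator_factor)
  show "convergent_prod (product_factor S a)"
    using product_factor_agree_1[OF assms] by (rule fps_prodinf)
  let ?f = "\<lambda>P. fps_const (a ^ num_overlined P) * fps_X ^ weight P"
  \<comment> \<open>\<open>X n\<close> contains every plane overpartition of weight
    \<open>n\<close>, and its bounds on parts and size are those of the finite formula and of the
    \<open>n\<close>-th coefficient of \<open>psum\<close>. Members of other weights contribute 0 to
    that coefficient.\<close>
  define X where
    "X n = {P \<in> plane_overpartitions_in {i \<in> S. i \<le> n}. psize (row_lengths P) \<le> n}" for n
  show "(?f has_sum (\<Prod>i. product_factor S a i)) (plane_overpartitions_in S)"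
  proof (rule fps_has_sumI[of X], intro conjI ballI)
    fix n
    let ?S = "{i \<in> S. i \<le> n}" and ?A = "{l \<in> partitions. psize l \<le> n}"
    let ?B = "SIGMA l:?A. tableaux (letters ?S) l"
    have S: "finite ?S" "0 \<notin> ?S"
      using assms by auto
    have fin: "finite (tableaux (letters ?S) l)" if "l \<in> ?A" for l
      using that S by (intro finite_tableaux finite_letters) auto
    have image: "(\<lambda>(l, T). filling_of l T) ` ?B = X n"
    proof
      show "(\<lambda>(l, T). filling_of l T) ` ?B \<subseteq> X n"
        using filling_of_tableau(1,2)[OF S(2)] by (auto simp: X_def)
      show "X n \<subseteq> (\<lambda>(l, T). filling_of l T) ` ?B"
      proof
        fix P assume "P \<in> X n"
        then have "P \<in> plane_overpartitions_in ?S" "psize (row_lengths P) \<le> n"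
          by (auto simp: X_def)
        then show "P \<in> (\<lambda>(l, T). filling_of l T) ` ?B"
          using tableau_of_filling[of P ?S]
          by (intro image_eqI[of _ _ "(row_lengths P, tableau_of P)"]) auto
      qed
    qed
    have B: "finite ?B"
      using fin finite_partitions_le by (intro finite_SigmaI) auto
    show "finite (X n)"
      unfolding image[symmetric] using B by (rule finite_imageI)
    show "X n \<subseteq> plane_overpartitions_in S"
      by (auto simp: X_def plane_overpartitions_in_def)
    \<comment> \<open>Weight \<open>n\<close> bounds every entry by \<open>n\<close> and, as entries
      are positive, also the number of cells.\<close>
    show "?f P $ n = 0" if "P \<in> plane_overpartitions_in S - X n" for P
    proof -
      have P: "P \<in> plane_overpartitions_in S" "P \<notin> X n"
        using that by auto
      have pos: "0 < entry P i j" if "(i, j) \<in> cells P" for i j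
        using P(1) that by (auto simp: plane_overpartitions_in_def plane_overpartition_def)
      have "weight P \<noteq> n"
      proof
        assume n: "weight P = n"
        have "entry P i j \<le> n" if "(i, j) \<in> cells P" for i j
          unfolding n[symmetric] weight_def
          using member_le_sum[of "(i, j)" "cells P" "\<lambda>(i, j). entry P i j"] that finite_cells[OF P(1)]
          by simp
        then have "P \<in> plane_overpartitions_in ?S"
          using P(1) by (auto simp: plane_overpartitions_in_def)
        moreover have "card (cells P) \<le> n"
          unfolding n[symmetric] weight_def card_eq_sum
          using pos by (intro sum_mono) (auto simp: Suc_le_eq)
        then have "psize (row_lengths P) \<le> n"
          using tableau_of_filling(1)[OF P(1)] by (simp add: cells_eq_diagram card_diagram)
        ultimately show False
          using P(2) by (simp add: X_def)
      qed
      then show ?thesis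
        by (simp add: fps_X_power_mult_right_nth)
    qed
    \<comment> \<open>Sorted by shape, \<open>X n\<close> runs over the shapes of size at most
      \<open>n\<close>, the very range of the \<open>n\<close>-th coefficient of
      \<open>psum\<close>.\<close>
    have "(\<Sum>P\<in>X n. ?f P $ n) = (\<Sum>(l, T)\<in>?B. tableau_weight (letter_weight a) T $ n)"
      by (rule sum.reindex_bij_witness[where i = "\<lambda>(l, T). filling_of l T"
            and j = "\<lambda>P. (row_lengths P, tableau_of P)"])
         (use tableau_of_filling[of _ ?S] filling_of_tableau[OF S(2)] filling_weight[of _ ?S a]
           in \<open>auto simp: X_def\<close>)
    also have "\<dots> = (\<Sum>l\<in>?A. \<Sum>T\<in>tableaux (letters ?S) l. tableau_weight (letter_weight a) T $ n)"
      by (rule sum.Sigma[symmetric]) (use fin finite_partitions_le in auto)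
    also have "\<dots> = psum (shape_gf a ?S) $ n"
      by (simp add: psum_nth tableau_gf_def fps_sum_nth)
    also have "\<dots> = (\<Prod>i\<in>?S. finite_factor ?S a i) $ n"
      using shape_gf_psum[OF S, of a] by simp
    also have "\<dots> = (\<Prod>i. product_factor S a i) $ n"
      using prodinf_product_factor[OF assms, of n a] by (simp add: agree_def)
    finally show "(\<Sum>P\<in>X n. ?f P $ n) = (\<Prod>i. product_factor S a i) $ n" .
  qed
qed

end
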